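(* Let $m\ge1$. For $k\ge3$, the terms of degree $k-1$ in $(-1)^kF_k(\mathbf p;-\mathbf q)$ are $\mathbf p,\mathbf q$-positive; that is, the homogeneous component of degree $k-1$ of the polynomial $(-1)^kF_k(\mathbf p;-\mathbf q)$ is $\mathbf p,\mathbf q$-positive.
   Context: Fix $m\ge1$ and indeterminates $\mathbf p=(p_1,\dots,p_m)$, $\mathbf q=(q_1,\dots,q_m)$; write $-\mathbf q=(-q_1,\dots,-q_m)$. "Degree" is total degree in the $p$'s and $q$'s. Normalized character: for partitions $\omega\vdash n$ and $1\le k\le n$, $\widehat\chi_\omega(k\,1^{n-k})=n(n-1)\cdots(n-k+1)\,\chi_\omega(k\,1^{n-k})/\chi_\omega(1^n)$, where $\chi_\omega(\lambda)$ is the irreducible character of the symmetric group $\mathfrak S_n$ indexed by $\omega$ evaluated on the class of cycle type $\lambda$, and $k\,1^{n-k}$ is the cycle type of a $k$-cycle. Shape $\mathbf p\times\mathbf q$: for positive integers $p_1,\dots,p_m$ and integers $q_1>q_2>\cdots>q_m>0$, $\mathbf p\times\mathbf q$ is the partition of $n=\sum_i p_iq_i$ having exactly $p_i$ parts equal to $q_i$ for $i=1,\dots,m$. Stanley's character polynomial $F_k(\mathbf p;\mathbf q)$ is the (unique) polynomial in the $p$'s and $q$'s with $F_k(\mathbf p;\mathbf q)=\widehat\chi_{\mathbf p\times\mathbf q}(k\,1^{n-k})$ for all such integer values with $n\ge k$. $F_k(\mathbf p;-\mathbf q)$ is obtained by replacing each $q_i$ by $-q_i$. A polynomial in the $p$'s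 and $q$'s is called $\mathbf p,\mathbf q$-positive if the coefficients of all its terms (i.e. all its nonzero coefficients) are positive. *)

theory Defs
  imports
    Complex_Main
    "HOL-Library.Poly_Mapping"
    "HOL-Library.Function_Algebras"
    "HOL-Combinatorics.Combinatorics"
begin

section \<open>The group algebra of the symmetric group\<close>

text \<open>The symmetric group on n letters is the set of permutations of {..<n}, with composition as
  product.  An element of its complex group algebra is a function from permutations to coefficients;
  such functions form a complex vector space under pointwise operations.\<close>

type_synonym grpalg = "(nat \<Rightarrow> nat) \<Rightarrow> complex"

definition ga_scale :: "complex \<Rightarrow> grpalg \<Rightarrow> grpalg" where
  "ga_scale c f = (\<lambda>\<sigma>. c * f \<sigma>)"

global_interpretation ga: vector_space ga_scale
  by unfold_locales (auto simp: ga_scale_def plus_fun_def algebra_simps)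

definition ga_unit :: "(nat \<Rightarrow> nat) \<Rightarrow> grpalg" where
  "ga_unit \<sigma> = (\<lambda>\<tau>. if \<tau> = \<sigma> then 1 else 0)"

text \<open>Left multiplication by a permutation: this is the linear extension of
  \<open>ga_unit \<tau> \<mapsto> ga_unit (\<sigma> \<circ> \<tau>)\<close>.\<close>

definition left_mult :: "(nat \<Rightarrow> nat) \<Rightarrow> grpalg \<Rightarrow> grpalg" where
  "left_mult \<sigma> f = (\<lambda>\<tau>. f (inv \<sigma> \<circ> \<tau>))"

text \<open>Trace of an endomorphism T of a finite-dimensional subspace V; the value does not depend on
  the basis that is chosen.\<close>

definition trace_on :: "grpalg set \<Rightarrow> (grpalg \<Rightarrow> grpalg) \<Rightarrow> complex" where
  "trace_on V T =
     (let B = (SOME B. ga.independent B \<and> ga.span B = V)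
      in \<Sum>b\<in>B. ga.representation B (T b) b)"


section \<open>Irreducible characters of the symmetric group\<close>

text \<open>A partition is the list of its parts in weakly decreasing order.  Its boxes are filled with
  0, 1, 2, \<dots> row by row from left to right; \<open>box_row\<close> and \<open>box_col\<close> locate an entry of this
  tableau.\<close>

definition box_row :: "nat list \<Rightarrow> nat \<Rightarrow> nat" where
  "box_row \<omega> x = (LEAST i. x < sum_list (take (Suc i) \<omega>))"

definition box_col :: "nat list \<Rightarrow> nat \<Rightarrow> nat" where
  "box_col \<omega> x = x - sum_list (take (box_row \<omega> x) \<omega>)"

definition row_stabilizer :: "nat list \<Rightarrow> (nat \<Rightarrow> nat) set" where
  "row_stabilizer \<omega> =
     {\<sigma>. \<sigma> permutes {..<sum_list \<omega>} \<and> (\<forall>x<sum_list \<omega>. box_row \<omega> (\<sigma> x) = box_row \<omega> x)}"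

definition col_stabilizer :: "nat list \<Rightarrow> (nat \<Rightarrow> nat) set" where
  "col_stabilizer \<omega> =
     {\<sigma>. \<sigma> permutes {..<sum_list \<omega>} \<and> (\<forall>x<sum_list \<omega>. box_col \<omega> (\<sigma> x) = box_col \<omega> x)}"

definition young_symmetrizer :: "nat list \<Rightarrow> grpalg" where
  "young_symmetrizer \<omega> =
     (\<Sum>u\<in>row_stabilizer \<omega>. \<Sum>v\<in>col_stabilizer \<omega>. ga_scale (of_int (sign v)) (ga_unit (u \<circ> v)))"

text \<open>The irreducible module indexed by \<open>\<omega>\<close>: the left ideal generated by the Young symmetrizer.
  With this convention the one-row partition gives the trivial representation.\<close>

definition specht_module :: "nat list \<Rightarrow> grpalg set" where
  "specht_module \<omega> =
     ga.span ((\<lambda>\<sigma>. left_mult \<sigma> (young_symmetrizer \<omega>)) ` {\<sigma>. \<sigma> permutes {..<sum_list \<omega>}})"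

definition irr_char :: "nat list \<Rightarrow> (nat \<Rightarrow> nat) \<Rightarrow> complex" where
  "irr_char \<omega> \<sigma> = trace_on (specht_module \<omega>) (left_mult \<sigma>)"

text \<open>The normalized character at the class of a k-cycle, evaluated at the representative
  \<open>(0 1 \<dots> k-1)\<close> of that class; for \<open>k \<le> sum_list \<omega>\<close>.\<close>

definition normalized_char :: "nat list \<Rightarrow> nat \<Rightarrow> complex" where
  "normalized_char \<omega> k =
     (\<Prod>i<k. of_nat (sum_list \<omega> - i)) * irr_char \<omega> (cycle_of_list [0..<k]) / irr_char \<omega> id"

definition pq_shape :: "nat \<Rightarrow> (nat \<Rightarrow> nat) \<Rightarrow> (nat \<Rightarrow> nat) \<Rightarrow> nat list" where
  "pq_shape m p q = concat (map (\<lambda>i. replicate (p i) (q i)) [1..<Suc m])"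


section \<open>Polynomials in the p's and q's\<close>

datatype pq_var = P nat | Q nat

text \<open>A monomial is its finitely supported exponent vector, a polynomial is a finitely supported
  coefficient function on monomials; ring operations are those of \<^theory>\<open>HOL-Library.Poly_Mapping\<close>.\<close>

type_synonym pq_monom = "pq_var \<Rightarrow>\<^sub>0 nat"
type_synonym pq_poly = "pq_monom \<Rightarrow>\<^sub>0 real"

definition pq_vars :: "pq_poly \<Rightarrow> pq_var set" where
  "pq_vars F = (\<Union>\<alpha>\<in>Poly_Mapping.keys F. Poly_Mapping.keys \<alpha>)"

text \<open>The ring homomorphism out of the polynomial ring that extends \<open>h\<close> on coefficients and sends
  each indeterminate v to \<open>s v\<close>.\<close>

definition pq_hom :: "(real \<Rightarrow> 'b::comm_ring_1) \<Rightarrow> (pq_var \<Rightarrow> 'b) \<Rightarrow> pq_poly \<Rightarrow> 'b" where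
  "pq_hom h s F =
     (\<Sum>\<alpha>\<in>Poly_Mapping.keys F. h (Poly_Mapping.lookup F \<alpha>) *
        (\<Prod>v\<in>Poly_Mapping.keys \<alpha>. s v ^ Poly_Mapping.lookup \<alpha> v))"

definition pq_const :: "real \<Rightarrow> pq_poly" where
  "pq_const c = Poly_Mapping.single 0 c"

definition pq_indet :: "pq_var \<Rightarrow> pq_poly" where
  "pq_indet v = Poly_Mapping.single (Poly_Mapping.single v 1) 1"

definition pq_eval :: "(nat \<Rightarrow> nat) \<Rightarrow> (nat \<Rightarrow> nat) \<Rightarrow> pq_poly \<Rightarrow> real" where
  "pq_eval p q = pq_hom (\<lambda>c. c) (\<lambda>v. case v of P i \<Rightarrow> real (p i) | Q i \<Rightarrow> real (q i))"

definition negate_q :: "pq_poly \<Rightarrow> pq_poly" where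
  "negate_q = pq_hom pq_const (\<lambda>v. case v of P i \<Rightarrow> pq_indet (P i) | Q i \<Rightarrow> - pq_indet (Q i))"

definition pq_monom_degree :: "pq_monom \<Rightarrow> nat" where
  "pq_monom_degree \<alpha> = (\<Sum>v\<in>Poly_Mapping.keys \<alpha>. Poly_Mapping.lookup \<alpha> v)"

definition homogeneous_component :: "nat \<Rightarrow> pq_poly \<Rightarrow> pq_poly" where
  "homogeneous_component d F =
     (\<Sum>\<alpha>\<in>{\<alpha> \<in> Poly_Mapping.keys F. pq_monom_degree \<alpha> = d}.
        Poly_Mapping.single \<alpha> (Poly_Mapping.lookup F \<alpha>))"

definition pq_positive :: "pq_poly \<Rightarrow> bool" where
  "pq_positive F \<longleftrightarrow> (\<forall>\<alpha>\<in>Poly_Mapping.keys F. Poly_Mapping.lookup F \<alpha> > 0)"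


section \<open>Stanley's character polynomial\<close>

definition is_stanley_poly :: "nat \<Rightarrow> nat \<Rightarrow> pq_poly \<Rightarrow> bool" where
  "is_stanley_poly m k F \<longleftrightarrow>
     pq_vars F \<subseteq> P ` {1..m} \<union> Q ` {1..m} \<and>
     (\<forall>p q :: nat \<Rightarrow> nat.
        (\<forall>i\<in>{1..m}. p i > 0) \<and> (\<forall>i\<in>{1..m}. q i > 0) \<and>
        (\<forall>i\<in>{1..m}. \<forall>j\<in>{1..m}. i < j \<longrightarrow> q i > q j) \<and>
        (\<Sum>i=1..m. p i * q i) \<ge> k \<longrightarrow>
        complex_of_real (pq_eval p q F) = normalized_char (pq_shape m p q) k)"

definition stanley_poly :: "nat \<Rightarrow> nat \<Rightarrow> pq_poly" where
  "stanley_poly m k = (THE F. is_stanley_poly m k F)"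

end

theory Submission
  imports Defs "HOL-Computational_Algebra.Polynomial"
begin

text \<open>
  The polynomial \<open>F\<^sub>k\<close> has an explicit form (Feray, Sniady): it is the sum, over the factorizations
  \<open>\<sigma> \<sigma>'\<close> of a \<open>k\<close>-cycle and the colourings of the cycles of \<open>\<sigma>\<close> by the blocks of equal rows, of the
  sign of \<open>\<sigma>'\<close> times one \<open>p\<close> for each cycle of \<open>\<sigma>\<close> and one \<open>q\<close> for each cycle of \<open>\<sigma>'\<close>. The sign of
  \<open>\<sigma>'\<close> is \<open>(-1)\<close> to the power \<open>k\<close> minus its number of cycles, so \<open>(-1)\<^sup>k F\<^sub>k(p; -q)\<close> is a sum of monomials
  with coefficient 1, in every degree.

  For the formula, the Young symmetrizer \<open>c\<close> is a nonzero multiple of an idempotent, so the normalized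
  character at \<open>\<sigma>\<close> is the average of \<open>c\<close> over the conjugates of \<open>inv \<sigma>\<close>. This is a signed count
  of pairs of a bijective filling of the diagram and a factorization that preserves its rows and its
  columns respectively. Only the entries below \<open>k\<close> matter, and fillings that put two of them in the
  same box cancel, so bijective fillings may be replaced by arbitrary maps of \<open>{..<k}\<close> to boxes.
\<close>

section \<open>Traces in the group algebra\<close>

text \<open>Passing to arbitrary maps is what makes the count split: for a fixed factorization they
  can be chosen independently on each cycle once the rows are coloured by blocks, so their number is
  a product over cycles. Injective maps would also have to avoid collisions between cycles. The
  conjugates of \<open>inv \<sigma>\<close> come from the trace of the map that sends
  \<open>x\<close> to the product of \<open>\<sigma>\<close>, \<open>x\<close> and \<open>c\<close>:
  the coefficient of its value at a group element \<open>g\<close>, taken at \<open>g\<close>, is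
  \<open>c (inv g \<circ> inv \<sigma> \<circ> g)\<close>. The factor by which \<open>c\<close>
  fails to be idempotent multiplies both characters in the ratio and cancels, so its value (a
  product of hook lengths) never has to be computed. Since \<open>stanley_poly\<close> is a definite
  description, the explicit polynomial must also be shown to be the only one with the prescribed
  values. These are prescribed only where \<open>q\<close> strictly decreases and the shape has at
  least \<open>k\<close> boxes, so the evaluation points in the uniqueness argument must respect
  both constraints.\<close>

abbreviation perms :: "nat \<Rightarrow> (nat \<Rightarrow> nat) set" where
  "perms n \<equiv> {\<sigma>. \<sigma> permutes {..<n}}"

lemma perms_permutation: "\<sigma> \<in> perms n \<Longrightarrow> permutation \<sigma>"
  by (auto simp: permutation_permutes)

lemma perms_bij: "\<sigma> \<in> perms n \<Longrightarrow> bij \<sigma>"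
  by (auto simp: permutes_bij)

lemma perms_comp: "\<sigma> \<in> perms n \<Longrightarrow> \<tau> \<in> perms n \<Longrightarrow> \<sigma> \<circ> \<tau> \<in> perms n"
  by (simp add: permutes_compose)

lemma finite_perms: "finite (perms n)"
  by (simp add: finite_permutations)

lemma inv_comp_cancel: "bij \<sigma> \<Longrightarrow> inv \<sigma> \<circ> (\<sigma> \<circ> f) = f" "bij \<sigma> \<Longrightarrow> \<sigma> \<circ> (inv \<sigma> \<circ> f) = f"
  "bij \<sigma> \<Longrightarrow> inv \<sigma> \<circ> \<sigma> = id" "bij \<sigma> \<Longrightarrow> \<sigma> \<circ> inv \<sigma> = id"
  by (auto simp: fun_eq_iff bij_is_inj bij_is_surj surj_f_inv_f)

lemma sum_fun_apply: "(\<Sum>i\<in>A. f i) x = (\<Sum>i\<in>A. f i x)"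
  by (induction A rule: infinite_finite_induct) auto

text \<open>The product of the group algebra. A \<open>grpalg\<close> is a function on all maps of
  naturals, so the sum is confined to the finite group \<open>perms n\<close>.\<close>

definition conv :: "nat \<Rightarrow> grpalg \<Rightarrow> grpalg \<Rightarrow> grpalg" where
  "conv n f g = (\<lambda>\<tau>. \<Sum>\<sigma>\<in>perms n. f \<sigma> * g (inv \<sigma> \<circ> \<tau>))"

lemma linear_conv_left: "Vector_Spaces.linear ga_scale ga_scale (\<lambda>f. conv n f g)"
  by unfold_locales
    (auto simp: conv_def ga_scale_def fun_eq_iff sum_distrib_left sum.distrib algebra_simps)

lemma linear_left_mult: "Vector_Spaces.linear ga_scale ga_scale (left_mult \<sigma>)"
  by unfold_locales (auto simp: left_mult_def ga_scale_def fun_eq_iff)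

text \<open>Associativity when the leftmost factor is a group element. It lets an identity for right
  multiplication by \<open>g\<close> spread from one element to the left ideal that it
  generates.\<close>

lemma conv_left_mult:
  assumes "\<sigma> \<in> perms n"
  shows "conv n (left_mult \<sigma> f) g = left_mult \<sigma> (conv n f g)"
proof
  fix \<tau>
  have "conv n (left_mult \<sigma> f) g \<tau> = (\<Sum>\<rho>\<in>perms n. f (inv \<sigma> \<circ> \<rho>) * g (inv \<rho> \<circ> \<tau>))"
    by (simp add: conv_def left_mult_def)
  also have "\<dots> = (\<Sum>\<rho>\<in>perms n. f (inv \<sigma> \<circ> (\<sigma> \<circ> \<rho>)) * g (inv (\<sigma> \<circ> \<rho>) \<circ> \<tau>))"
    using assms by (intro setum_permutations_compose_left) auto
  also have "\<dots> = (\<Sum>\<rho>\<in>perms n. f \<rho> * g (inv \<rho> \<circ> (inv \<sigma> \<circ> \<tau>)))"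
    using assms by (intro sum.cong refl)
      (simp add: inv_comp_cancel perms_bij permutes_bij o_inv_distrib o_assoc)
  finally show "conv n (left_mult \<sigma> f) g \<tau> = left_mult \<sigma> (conv n f g) \<tau>"
    by (simp add: conv_def left_mult_def)
qed

lemma left_mult_left_mult:
  "bij \<sigma> \<Longrightarrow> bij \<tau> \<Longrightarrow> left_mult \<sigma> (left_mult \<tau> f) = left_mult (\<sigma> \<circ> \<tau>) f"
  by (simp add: left_mult_def o_inv_distrib o_assoc)

lemma conv_ga_unit:
  assumes "g \<in> perms n"
  shows "conv n (ga_unit g) f = left_mult g f"
proof
  fix \<tau>
  have "conv n (ga_unit g) f \<tau> = (\<Sum>\<sigma>\<in>perms n. if \<sigma> = g then f (inv g \<circ> \<tau>) else 0)"
    unfolding conv_def by (intro sum.cong) (auto simp: ga_unit_def)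
  then show "conv n (ga_unit g) f \<tau> = left_mult g f \<tau>"
    using assms finite_perms[of n] by (simp add: left_mult_def del: mem_Collect_eq)
qed

lemma grpalg_eq_sum_units:
  assumes "\<And>\<tau>. \<tau> \<notin> perms n \<Longrightarrow> f \<tau> = 0"
  shows "f = (\<Sum>g\<in>perms n. ga_scale (f g) (ga_unit g))"
proof
  fix \<tau>
  have "(\<Sum>g\<in>perms n. ga_scale (f g) (ga_unit g)) \<tau> = (\<Sum>g\<in>perms n. if \<tau> = g then f g else 0)"
    unfolding sum_fun_apply by (intro sum.cong) (auto simp: ga_scale_def ga_unit_def)
  also have "\<dots> = f \<tau>"
    using assms finite_perms[of n] by (simp del: mem_Collect_eq)
  finally show "f \<tau> = (\<Sum>g\<in>perms n. ga_scale (f g) (ga_unit g)) \<tau>" by simp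
qed

text \<open>Both sides are the trace of \<open>L\<close>: over the basis of group elements of the whole group
  algebra, and over a basis of a subspace that contains its image.\<close>

lemma sum_diagonal_eq_sum_representation:
  assumes L: "Vector_Spaces.linear ga_scale ga_scale L"
    and B: "ga.independent B" "finite B"
    and supp: "\<And>b \<tau>. b \<in> B \<Longrightarrow> \<tau> \<notin> perms n \<Longrightarrow> b \<tau> = 0"
    and im: "\<And>g. g \<in> perms n \<Longrightarrow> L (ga_unit g) \<in> ga.span B"
  shows "(\<Sum>g\<in>perms n. L (ga_unit g) g) = (\<Sum>b\<in>B. ga.representation B (L b) b)"
proof -
  interpret L: Vector_Spaces.linear ga_scale ga_scale L by (rule L)
  have "(\<Sum>g\<in>perms n. L (ga_unit g) g) =
      (\<Sum>g\<in>perms n. \<Sum>b\<in>B. ga.representation B (L (ga_unit g)) b * b g)"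
  proof (intro sum.cong refl)
    fix g assume g: "g \<in> perms n"
    have "L (ga_unit g) = (\<Sum>b\<in>B. ga_scale (ga.representation B (L (ga_unit g)) b) b)"
      by (rule ga.sum_representation_eq[symmetric]) (use B im[OF g] in auto)
    from arg_cong[OF this, of "\<lambda>f. f g"]
    show "L (ga_unit g) g = (\<Sum>b\<in>B. ga.representation B (L (ga_unit g)) b * b g)"
      by (simp add: sum_fun_apply ga_scale_def)
  qed
  \<comment> \<open>With the sums exchanged, the inner sum is the \<open>b\<close>-coordinate of
    \<open>L\<close> applied to the expansion of \<open>b\<close> in group elements.\<close>
  also have "\<dots> = (\<Sum>b\<in>B. \<Sum>g\<in>perms n. b g * ga.representation B (L (ga_unit g)) b)"
    by (subst sum.swap) (simp add: mult.commute)
  also have "\<dots> = (\<Sum>b\<in>B. ga.representation B (L b) b)"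
  proof (intro sum.cong refl)
    fix b assume b: "b \<in> B"
    have "L b = (\<Sum>g\<in>perms n. ga_scale (b g) (L (ga_unit g)))"
      by (subst grpalg_eq_sum_units[of n b]) (use supp b in \<open>simp_all add: L.sum L.scale\<close>)
    then have "ga.representation B (L b) b =
        (\<Sum>g\<in>perms n. ga.representation B (ga_scale (b g) (L (ga_unit g))) b)"
      using im ga.representation_sum[OF B(1), of "perms n" "\<lambda>g. ga_scale (b g) (L (ga_unit g))"]
      by (simp only: sum_fun_apply[symmetric]) (simp add: ga.span_scale sum_fun_apply)
    also have "\<dots> = (\<Sum>g\<in>perms n. b g * ga.representation B (L (ga_unit g)) b)"
      using im by (intro sum.cong) (auto simp: ga.representation_scale[OF B(1)])
    finally show "(\<Sum>g\<in>perms n. b g * ga.representation B (L (ga_unit g)) b) =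
        ga.representation B (L b) b" by simp
  qed
  finally show ?thesis .
qed

text \<open>The Young symmetrizer is a multiple of an idempotent, so the trace on the left ideal that it
  generates is a trace on the whole group algebra. The trace of the identity shows that
  \<open>\<kappa> \<noteq> 0\<close>.\<close>

lemma trace_on_left_ideal:
  fixes c :: grpalg and n :: nat
  defines "V \<equiv> ga.span ((\<lambda>\<sigma>. left_mult \<sigma> c) ` perms n)"
  assumes supp: "\<forall>\<tau>. \<tau> \<notin> perms n \<longrightarrow> c \<tau> = 0"
    and idem: "conv n c c = ga_scale \<kappa> c"
    and one: "c id = 1"
  shows "\<kappa> \<noteq> 0"
    and "\<sigma> \<in> perms n \<Longrightarrow>
      \<kappa> * trace_on V (left_mult \<sigma>) = (\<Sum>g\<in>perms n. c (inv g \<circ> inv \<sigma> \<circ> g))"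
proof -
  \<comment> \<open>The same choice term as in \<open>trace_on\<close>, so that the trace unfolds to
    a sum over this very basis.\<close>
  define B where "B = (SOME B. ga.independent B \<and> ga.span B = V)"
  have "\<exists>B. ga.independent B \<and> ga.span B = V"
    by (metis V_def ga.maximal_independent_subset ga.span_eq ga.span_mono ga.span_span subset_antisym)
  then have B: "ga.independent B" "ga.span B = V"
    unfolding B_def by (rule someI2_ex; blast)+
  have BV: "B \<subseteq> V" using B(2) ga.span_superset by blast
  \<comment> \<open>Without finiteness the sum in \<open>trace_on\<close> would take its default
    value 0.\<close>
  have finB: "finite B"
    using ga.independent_span_bound[OF _ B(1), of "(\<lambda>\<sigma>. left_mult \<sigma> c) ` perms n"] BV finite_perms
    by (auto simp: V_def)
  have Vsupp: "b \<tau> = 0" if "b \<in> V" "\<tau> \<notin> perms n" for b \<tau>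
  proof -
    have "\<forall>\<tau>. \<tau> \<notin> perms n \<longrightarrow> b \<tau> = 0" using that(1) unfolding V_def
    proof (induction rule: ga.span_induct_alt)
      case base then show ?case by simp
    next
      case (step a x y)
      then obtain \<rho> where \<rho>: "\<rho> \<in> perms n" "x = left_mult \<rho> c" by auto
      have "inv \<rho> \<circ> \<tau> \<notin> perms n" if "\<tau> \<notin> perms n" for \<tau>
      proof
        assume "inv \<rho> \<circ> \<tau> \<in> perms n"
        from perms_comp[OF \<rho>(1) this] show False
          using that \<rho>(1) by (simp add: inv_comp_cancel permutes_bij)
      qed
      then show ?case using supp step(2) \<rho>(2) by (simp add: left_mult_def ga_scale_def)
    qed
    then show ?thesis using that(2) by blast
  qed
  \<comment> \<open>Right multiplication by \<open>c\<close> commutes with left multiplications, so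
    its effect on the generator \<open>c\<close>, the scalar \<open>\<kappa>\<close>, is its effect
    on all of \<open>V\<close>.\<close>
  have VE: "conv n b c = ga_scale \<kappa> b" if "b \<in> V" for b
    using that unfolding V_def
  proof (induction rule: ga.span_induct_alt)
    case base show ?case by (simp add: conv_def ga_scale_def fun_eq_iff)
  next
    case (step a x y)
    interpret C: Vector_Spaces.linear ga_scale ga_scale "\<lambda>f. conv n f c" by (rule linear_conv_left)
    obtain \<rho> where \<rho>: "\<rho> \<in> perms n" "x = left_mult \<rho> c" using step(1) by auto
    have "conv n x c = ga_scale \<kappa> x"
      unfolding \<rho>(2) conv_left_mult[OF \<rho>(1)] idem by (simp add: left_mult_def ga_scale_def)
    then show ?case using step(2)
      by (simp only: C.add C.scale ga.scale_right_distrib ga.scale_scale mult.commute)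
  qed
  have key: "(\<Sum>g\<in>perms n. c (inv g \<circ> inv \<sigma> \<circ> g)) =
      \<kappa> * (\<Sum>b\<in>B. ga.representation B (left_mult \<sigma> b) b)" if \<sigma>: "\<sigma> \<in> perms n" for \<sigma>
  proof -
    \<comment> \<open>This map sends the whole algebra into \<open>V\<close> and equals
      \<open>\<kappa>\<close> times \<open>left_mult \<sigma>\<close> on \<open>V\<close>; its trace
      on the group elements is the sum over conjugates.\<close>
    let ?L = "\<lambda>f. left_mult \<sigma> (conv n f c)"
    interpret M: Vector_Spaces.linear ga_scale ga_scale "left_mult \<sigma>" by (rule linear_left_mult)
    have lin: "Vector_Spaces.linear ga_scale ga_scale ?L"
      using Vector_Spaces.linear_compose[OF linear_conv_left linear_left_mult] by (simp add: o_def)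
    have unit: "?L (ga_unit g) = left_mult (\<sigma> \<circ> g) c" if "g \<in> perms n" for g
      using that \<sigma> by (simp add: conv_ga_unit left_mult_left_mult permutes_bij)
    have "(\<Sum>g\<in>perms n. c (inv g \<circ> inv \<sigma> \<circ> g)) = (\<Sum>g\<in>perms n. ?L (ga_unit g) g)"
      using \<sigma> by (intro sum.cong refl)
        (simp only: unit, simp add: left_mult_def o_inv_distrib permutes_bij)
    also have "\<dots> = (\<Sum>b\<in>B. ga.representation B (?L b) b)"
    proof (rule sum_diagonal_eq_sum_representation[OF lin B(1) finB])
      show "b \<tau> = 0" if "b \<in> B" "\<tau> \<notin> perms n" for b \<tau> using Vsupp that BV by blast
      show "?L (ga_unit g) \<in> ga.span B" if "g \<in> perms n" for g
        unfolding unit[OF that] B(2) V_def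
        using perms_comp[OF \<sigma> that] by (blast intro: ga.span_base)
    qed
    also have "\<dots> = (\<Sum>b\<in>B. \<kappa> * ga.representation B (left_mult \<sigma> b) b)"
    proof (intro sum.cong refl)
      fix b assume b: "b \<in> B"
      have "left_mult \<sigma> b \<in> V" if "b \<in> V" for b
        using that unfolding V_def
      proof (induction rule: ga.span_induct_alt)
        case base show ?case by (simp only: M.zero ga.span_zero)
      next
        case (step a x y)
        then obtain \<rho> where \<rho>: "\<rho> \<in> perms n" "x = left_mult \<rho> c" by auto
        then have "left_mult \<sigma> x = left_mult (\<sigma> \<circ> \<rho>) c"
          using \<sigma> by (simp add: left_mult_left_mult permutes_bij)
        moreover have "left_mult (\<sigma> \<circ> \<rho>) c \<in> (\<lambda>\<sigma>. left_mult \<sigma> c) ` perms n"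
          using perms_comp[OF \<sigma> \<rho>(1)] by blast
        ultimately show ?case using step(2)
          by (simp only: M.add M.scale) (metis ga.span_add ga.span_scale ga.span_base)
      qed
      then have "left_mult \<sigma> b \<in> ga.span B" using b BV B(2) by blast
      then show "ga.representation B (?L b) b = \<kappa> * ga.representation B (left_mult \<sigma> b) b"
        using b BV by (subst VE) (auto simp: M.scale ga.representation_scale[OF B(1)])
    qed
    finally show ?thesis by (simp add: sum_distrib_left)
  qed
  show "\<kappa> \<noteq> 0"
  proof
    assume "\<kappa> = 0"
    then have "(\<Sum>g\<in>perms n. c (inv g \<circ> inv id \<circ> g)) = 0"
      using key[of id] by (simp add: permutes_id)
    moreover have "(\<Sum>g\<in>perms n. c (inv g \<circ> inv id \<circ> g)) = (\<Sum>g\<in>perms n. 1)"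
      by (intro sum.cong refl) (simp add: inv_comp_cancel permutes_bij one)
    ultimately show False using finite_perms[of n] permutes_id[of "{..<n}"]
      by (auto simp: card_eq_0_iff)
  qed
  show "\<kappa> * trace_on V (left_mult \<sigma>) = (\<Sum>g\<in>perms n. c (inv g \<circ> inv \<sigma> \<circ> g))"
    if "\<sigma> \<in> perms n"
    using key[OF that] by (simp add: trace_on_def B_def[symmetric])
qed

section \<open>Young symmetrizers\<close>

lemma sum_take_mono: "i \<le> j \<Longrightarrow> sum_list (take i \<omega>) \<le> sum_list (take j (\<omega>::nat list))"
  by (metis le_add1 min.absorb2 sum_list_append take_add le_Suc_ex)

lemma sum_take_Suc: "i < length \<omega> \<Longrightarrow> sum_list (take (Suc i) \<omega>) = sum_list (take i \<omega>) + \<omega> ! i"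
  by (simp add: take_Suc_conv_app_nth)

lemma box_position:
  assumes "i < length \<omega>" "j < \<omega> ! i"
  defines "x \<equiv> sum_list (take i \<omega>) + j"
  shows "box_row \<omega> x = i" "box_col \<omega> x = j" "x < sum_list \<omega>"
proof -
  show r: "box_row \<omega> x = i" unfolding box_row_def
  proof (rule Least_equality)
    show "x < sum_list (take (Suc i) \<omega>)" using assms by (simp add: sum_take_Suc)
    show "i \<le> i'" if "x < sum_list (take (Suc i') \<omega>)" for i'
    proof (rule ccontr)
      assume "\<not> i \<le> i'"
      then have "sum_list (take (Suc i') \<omega>) \<le> sum_list (take i \<omega>)" by (intro sum_take_mono) simp
      then show False using that by (simp add: x_def)
    qed
  qed
  show "box_col \<omega> x = j" by (simp add: box_col_def r) (simp add: x_def)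
  have "sum_list (take (Suc i) \<omega>) \<le> sum_list (take (length \<omega>) \<omega>)"
    using assms by (intro sum_take_mono) simp
  then show "x < sum_list \<omega>" using assms by (simp add: sum_take_Suc)
qed

lemma box_in_diagram:
  assumes "x < sum_list \<omega>"
  shows "box_row \<omega> x < length \<omega>" "box_col \<omega> x < \<omega> ! box_row \<omega> x"
    "sum_list (take (box_row \<omega> x) \<omega>) + box_col \<omega> x = x"
proof -
  let ?r = "box_row \<omega> x"
  have "\<omega> \<noteq> []" using assms by auto
  then have 1: "x < sum_list (take (Suc (length \<omega> - 1)) \<omega>)" using assms by simp
  then have 2: "x < sum_list (take (Suc ?r) \<omega>)" unfolding box_row_def by (rule LeastI)
  have "?r \<le> length \<omega> - 1" unfolding box_row_def by (rule Least_le) (rule 1)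
  then show 3: "?r < length \<omega>" using \<open>\<omega> \<noteq> []\<close> by (cases \<omega>) auto
  have 4: "sum_list (take ?r \<omega>) \<le> x"
  proof (cases ?r)
    case (Suc r')
    then have "\<not> x < sum_list (take (Suc r') \<omega>)"
      unfolding box_row_def by (intro not_less_Least) simp
    then show ?thesis using Suc by simp
  qed simp
  then show "sum_list (take ?r \<omega>) + box_col \<omega> x = x" by (simp add: box_col_def)
  then show "box_col \<omega> x < \<omega> ! ?r" using 2 3 by (simp add: sum_take_Suc)
qed

lemma bij_betw_boxes:
  "bij_betw (\<lambda>x. (box_row \<omega> x, box_col \<omega> x)) {..<sum_list \<omega>} (SIGMA i:{..<length \<omega>}. {..<\<omega> ! i})"
  by (rule bij_betw_byWitness[where f' = "\<lambda>(i, j). sum_list (take i \<omega>) + j"])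
    (auto simp: box_position box_in_diagram)

text \<open>Removing the largest element \<open>b\<close> leaves a subset of \<open>{..<b}\<close>,
  so \<open>b\<close> is at least the number of remaining elements. The equality case is what
  identifies the columns occupied by a row.\<close>

lemma sum_initial_segment_le:
  fixes X :: "nat set"
  assumes "finite X"
  shows "\<Sum>{..<card X} \<le> \<Sum>X \<and> (\<Sum>X = \<Sum>{..<card X} \<longrightarrow> X = {..<card X})"
  using assms
proof (induction X rule: finite_linorder_max_induct)
  case (insert b A)
  have "A \<subseteq> {..<b}" using insert by auto
  then have "card A \<le> b" using card_mono[of "{..<b}" A] by simp
  moreover have "b \<notin> A" using insert by auto
  ultimately show ?case using insert by (auto simp: lessThan_Suc)
qed simp

text \<open>The combinatorial core of Young's lemma. Summing the column indices shows that the boxes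
  \<open>(row a, col (h a))\<close> fill each row from the left, since they have the same row lengths and the
  same total column index as the diagram.\<close>

lemma exists_row_perm:
  fixes row col h :: "nat \<Rightarrow> nat"
  assumes bij: "bij_betw (\<lambda>x. (row x, col x)) {..<n} (SIGMA i:{..<l}. {..<w i})"
    and h: "h permutes {..<n}"
    and sep: "\<And>a b. a < n \<Longrightarrow> b < n \<Longrightarrow> row a = row b \<Longrightarrow> col (h a) = col (h b) \<Longrightarrow> a = b"
  shows "\<exists>u. u permutes {..<n} \<and> (\<forall>a<n. row (u a) = row a \<and> col (u a) = col (h a))"
proof -
  define A where "A r = {a\<in>{..<n}. row a = r}" for r
  have finA: "finite (A r)" for r by (simp add: A_def)
  have img: "(\<lambda>x. (row x, col x)) ` {..<n} = (SIGMA i:{..<l}. {..<w i})"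
    using bij by (simp add: bij_betw_def)
  have rowl: "row a < l" if "a < n" for a using img that by blast
  have injA: "inj_on col (A r)" for r
    using bij unfolding bij_betw_def inj_on_def A_def by auto
  have colA: "col ` A r = {..<w r}" if r: "r < l" for r
  proof
    show "col ` A r \<subseteq> {..<w r}" using img by (auto simp: A_def)
    show "{..<w r} \<subseteq> col ` A r"
    proof
      fix j assume "j \<in> {..<w r}"
      then have "(r, j) \<in> (\<lambda>x. (row x, col x)) ` {..<n}" using img r by simp
      then show "j \<in> col ` A r" by (auto simp: A_def)
    qed
  qed
  have cardA: "card (A r) = w r" if "r < l" for r
    using card_image[OF injA[of r]] colA[OF that] by simp
  have injh: "inj_on (\<lambda>a. col (h a)) (A r)" for r
    using sep by (auto simp: A_def inj_on_def)
  define X where "X r = (\<lambda>a. col (h a)) ` A r" for r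
  have cardX: "card (X r) = w r" if "r < l" for r
    using card_image[OF injh[of r]] cardA[OF that] by (simp add: X_def)
  have finX: "finite (X r)" for r by (simp add: X_def finA)
  have group: "(\<Sum>a<n. f a) = (\<Sum>r<l. \<Sum>a\<in>A r. f a)" for f :: "nat \<Rightarrow> nat"
    unfolding A_def by (rule sum.group[symmetric]) (use rowl in auto)
  \<comment> \<open>The left side is the sum of the column indices of all boxes; the permutation
    \<open>h\<close> leaves it unchanged.\<close>
  have "(\<Sum>r<l. \<Sum>{..<w r}) = (\<Sum>r<l. \<Sum>a\<in>A r. col a)"
  proof (rule sum.cong[OF refl])
    fix r assume "r \<in> {..<l}"
    then have "\<Sum>{..<w r} = \<Sum>(col ` A r)" using colA by simp
    also have "\<dots> = (\<Sum>a\<in>A r. col a)" by (simp add: sum.reindex[OF injA])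
    finally show "\<Sum>{..<w r} = (\<Sum>a\<in>A r. col a)" .
  qed
  also have "\<dots> = (\<Sum>a<n. col a)" by (rule group[symmetric])
  also have "\<dots> = (\<Sum>a<n. col (h a))" using sum.permute[OF h, of col] by (simp add: o_def)
  also have "\<dots> = (\<Sum>r<l. \<Sum>a\<in>A r. col (h a))" by (rule group)
  also have "\<dots> = (\<Sum>r<l. \<Sum>(X r))"
    by (simp add: X_def sum.reindex[OF injh] o_def)
  finally have total: "(\<Sum>r<l. \<Sum>{..<w r}) = (\<Sum>r<l. \<Sum>(X r))" .
  \<comment> \<open>No row falls below its minimal column sum and the totals agree, so every row
    attains the minimum.\<close>
  have X: "X r = {..<w r}" if r: "r < l" for r
  proof -
    have "\<Sum>{..<w r} = \<Sum>(X r)"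
    proof (rule sum_mono_inv[OF total])
      show "\<Sum>{..<w i} \<le> \<Sum>(X i)" if "i \<in> {..<l}" for i
        using sum_initial_segment_le[OF finX, of i] cardX[of i] that by simp
    qed (use r in auto)
    then show ?thesis using sum_initial_segment_le[OF finX, of r] cardX[OF r] by simp
  qed
  have "\<exists>b. b < n \<and> row b = row a \<and> col b = col (h a)" if a: "a < n" for a
  proof -
    have "col (h a) \<in> X (row a)" using a by (auto simp: X_def A_def)
    then have "col (h a) \<in> col ` A (row a)" using X colA rowl[OF a] by simp
    then show ?thesis by (auto simp: A_def)
  qed
  then obtain u where u: "\<And>a. a < n \<Longrightarrow> u a < n \<and> row (u a) = row a \<and> col (u a) = col (h a)"
    by metis
  \<comment> \<open>\<open>u\<close> is constrained only below \<open>n\<close>;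
    \<open>permutes\<close> requires the identity elsewhere. Injectivity below \<open>n\<close> is
    exactly the hypothesis \<open>sep\<close>.\<close>
  define u' where "u' a = (if a < n then u a else a)" for a
  have "inj_on u' {..<n}"
  proof (rule inj_onI)
    fix a b assume "a \<in> {..<n}" "b \<in> {..<n}" "u' a = u' b"
    then show "a = b" using u[of a] u[of b] sep[of a b] by (simp add: u'_def)
  qed
  moreover have "u' ` {..<n} \<subseteq> {..<n}" using u by (auto simp: u'_def)
  ultimately have "bij_betw u' {..<n} {..<n}"
    by (simp add: bij_betw_def endo_inj_surj)
  then have "u' permutes {..<n}" by (intro bij_imp_permutes) (auto simp: u'_def)
  then show ?thesis using u by (intro exI[of _ u']) (auto simp: u'_def)
qed

section \<open>Row and column stabilizers, and the functions that transform under them\<close>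

lemma row_stabilizer_id: "id \<in> row_stabilizer \<omega>"
  and col_stabilizer_id: "id \<in> col_stabilizer \<omega>"
  by (auto simp: row_stabilizer_def col_stabilizer_def permutes_id)

lemma permutes_less: "\<sigma> permutes {..<n} \<Longrightarrow> x < n \<Longrightarrow> \<sigma> x < (n::nat)"
  using permutes_in_image[of \<sigma> "{..<n}" x] by simp

lemma row_stabilizer_comp:
  "u \<in> row_stabilizer \<omega> \<Longrightarrow> u' \<in> row_stabilizer \<omega> \<Longrightarrow> u \<circ> u' \<in> row_stabilizer \<omega>"
  by (auto simp: row_stabilizer_def permutes_compose permutes_less)

lemma col_stabilizer_comp:
  "u \<in> col_stabilizer \<omega> \<Longrightarrow> u' \<in> col_stabilizer \<omega> \<Longrightarrow> u \<circ> u' \<in> col_stabilizer \<omega>"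
  by (auto simp: col_stabilizer_def permutes_compose permutes_less)

lemma invariant_inv:
  assumes "u permutes {..<n::nat}" "\<forall>x<n. f (u x) = f x"
  shows "\<forall>x<n. f (inv u x) = f x"
  by (metis assms permutes_inv permutes_inverses(1) permutes_less)

lemma row_stabilizer_inv: "u \<in> row_stabilizer \<omega> \<Longrightarrow> inv u \<in> row_stabilizer \<omega>"
  unfolding row_stabilizer_def using invariant_inv[of u "sum_list \<omega>" "box_row \<omega>"]
  by (simp add: permutes_inv)

lemma col_stabilizer_inv: "u \<in> col_stabilizer \<omega> \<Longrightarrow> inv u \<in> col_stabilizer \<omega>"
  unfolding col_stabilizer_def using invariant_inv[of u "sum_list \<omega>" "box_col \<omega>"]
  by (simp add: permutes_inv)

lemma row_stabilizer_perms: "u \<in> row_stabilizer \<omega> \<Longrightarrow> u \<in> perms (sum_list \<omega>)"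
  and col_stabilizer_perms: "u \<in> col_stabilizer \<omega> \<Longrightarrow> u \<in> perms (sum_list \<omega>)"
  by (auto simp: row_stabilizer_def col_stabilizer_def)

lemma row_stabilizer_bij: "u \<in> row_stabilizer \<omega> \<Longrightarrow> bij u"
  and col_stabilizer_bij: "u \<in> col_stabilizer \<omega> \<Longrightarrow> bij u"
  by (auto dest!: row_stabilizer_perms col_stabilizer_perms simp: permutes_bij)

text \<open>An entry is recovered from its row and its column, so a permutation that keeps both
  moves nothing.\<close>

lemma stabilizers_disjoint:
  assumes "u \<in> row_stabilizer \<omega>" "u \<in> col_stabilizer \<omega>"
  shows "u = id"
proof
  fix x
  have u: "u permutes {..<sum_list \<omega>}" using assms by (simp add: row_stabilizer_def)
  show "u x = id x"
  proof (cases "x < sum_list \<omega>")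
    case True
    then have "box_row \<omega> (u x) = box_row \<omega> x" "box_col \<omega> (u x) = box_col \<omega> x" "u x < sum_list \<omega>"
      using assms u by (auto simp: row_stabilizer_def col_stabilizer_def permutes_less)
    then show ?thesis using True box_in_diagram(3)[of x \<omega>] box_in_diagram(3)[of "u x" \<omega>] by simp
  next
    case False
    then show ?thesis using u by (simp add: permutes_not_in)
  qed
qed

text \<open>The transformation law of the Young symmetrizer. Its solutions are determined up to a
  scalar, and the square of the symmetrizer is a solution too; this is how the square becomes a
  multiple of the symmetrizer.\<close>

definition young_equivariant :: "nat list \<Rightarrow> grpalg \<Rightarrow> bool" where
  "young_equivariant \<omega> F \<longleftrightarrow>
     (\<forall>u\<in>row_stabilizer \<omega>. \<forall>\<tau>. F (u \<circ> \<tau>) = F \<tau>) \<and>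
     (\<forall>v\<in>col_stabilizer \<omega>. \<forall>\<tau>. F (\<tau> \<circ> v) = of_int (sign v) * F \<tau>) \<and>
     (\<forall>\<tau>. \<tau> \<notin> perms (sum_list \<omega>) \<longrightarrow> F \<tau> = 0)"

text \<open>Either \<open>inv \<tau>\<close> puts two entries of one row into the same column; then
  a row transposition on the left of \<open>\<tau>\<close> equals a column transposition on its
  right, and the value at \<open>\<tau>\<close> is its own negative. Or no such pair exists; then
  \<open>exists_row_perm\<close> writes \<open>\<tau>\<close> as a row permutation followed on the
  right by a column permutation, and the value at \<open>\<tau>\<close> is a sign times the value at
  \<open>id\<close>.\<close>

lemma young_equivariant_unique:
  assumes F: "young_equivariant \<omega> F" and G: "young_equivariant \<omega> G"
  shows "F \<tau> * G id = F id * G \<tau>"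
proof (cases "\<tau> \<in> perms (sum_list \<omega>)")
  case False
  then show ?thesis using F G by (auto simp: young_equivariant_def)
next
  case \<tau>: True
  let ?n = "sum_list \<omega>"
  have bij: "bij \<tau>" using \<tau> by (simp add: permutes_bij)
  have inv\<tau>: "inv \<tau> permutes {..<?n}" using \<tau> by (simp add: permutes_inv)
  show ?thesis
  proof (cases "\<exists>a<?n. \<exists>b<?n. a \<noteq> b \<and> box_row \<omega> a = box_row \<omega> b \<and>
      box_col \<omega> (inv \<tau> a) = box_col \<omega> (inv \<tau> b)")
    case True
    then obtain a b where ab: "a < ?n" "b < ?n" "a \<noteq> b" "box_row \<omega> a = box_row \<omega> b"
      "box_col \<omega> (inv \<tau> a) = box_col \<omega> (inv \<tau> b)" by blast
    let ?t = "Transposition.transpose a b" and ?s = "Transposition.transpose (inv \<tau> a) (inv \<tau> b)"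
    have "?t permutes {..<?n}" using ab by (intro permutes_swap_id) auto
    then have t: "?t \<in> row_stabilizer \<omega>"
      using ab by (auto simp: row_stabilizer_def Transposition.transpose_def)
    have "?s permutes {..<?n}" using ab inv\<tau> by (intro permutes_swap_id) (auto simp: permutes_less)
    then have s: "?s \<in> col_stabilizer \<omega>"
      using ab by (auto simp: col_stabilizer_def Transposition.transpose_def)
    have ts: "?t \<circ> \<tau> = \<tau> \<circ> ?s"
      using bij by (auto simp: fun_eq_iff Transposition.transpose_def bij_is_surj surj_f_inv_f
          bij_is_inj inv_f_f bij_inv_eq_iff)
    have "inv \<tau> a \<noteq> inv \<tau> b" using ab(3) bij by (metis bij_inv_eq_iff)
    then have "sign ?s = -1" by (simp add: sign_swap_id)
    then have z: "H \<tau> = 0" if "young_equivariant \<omega> H" for H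
    proof -
      have "H (?t \<circ> \<tau>) = H \<tau>" "H (\<tau> \<circ> ?s) = of_int (sign ?s) * H \<tau>"
        using that t s unfolding young_equivariant_def by blast+
      then show "H \<tau> = 0" unfolding ts using \<open>sign ?s = -1\<close> by simp
    qed
    show ?thesis using z[OF F] z[OF G] by simp
  next
    case False
    have sep: "a = b" if "a < ?n" "b < ?n" "box_row \<omega> a = box_row \<omega> b"
      "box_col \<omega> (inv \<tau> a) = box_col \<omega> (inv \<tau> b)" for a b
      using False that by blast
    obtain u where u: "u permutes {..<?n}" "\<And>a. a < ?n \<Longrightarrow> box_row \<omega> (u a) = box_row \<omega> a"
      "\<And>a. a < ?n \<Longrightarrow> box_col \<omega> (u a) = box_col \<omega> (inv \<tau> a)"
      using exists_row_perm[OF bij_betw_boxes inv\<tau> sep] by blast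
    have uR: "u \<in> row_stabilizer \<omega>" using u by (simp add: row_stabilizer_def)
    \<comment> \<open>The column of \<open>u (\<tau> x)\<close> is that of
      \<open>inv \<tau> (\<tau> x)\<close>, hence that of \<open>x\<close>.\<close>
    have v: "u \<circ> \<tau> \<in> col_stabilizer \<omega>"
      unfolding col_stabilizer_def using u \<tau> bij
      by (auto simp: permutes_compose permutes_less bij_is_inj inv_f_f)
    have z: "H \<tau> = of_int (sign (u \<circ> \<tau>)) * H id" if H: "young_equivariant \<omega> H" for H
    proof -
      have "H \<tau> = H (inv u \<circ> (id \<circ> (u \<circ> \<tau>)))" using uR by (simp add: inv_comp_cancel row_stabilizer_bij)
      also have "\<dots> = of_int (sign (u \<circ> \<tau>)) * H id"
        using H v row_stabilizer_inv[OF uR] unfolding young_equivariant_def by metis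
      finally show ?thesis .
    qed
    show ?thesis using z[OF F] z[OF G] by simp
  qed
qed

lemma young_symmetrizer_apply:
  "young_symmetrizer \<omega> \<tau> =
     (\<Sum>u\<in>row_stabilizer \<omega>. \<Sum>v\<in>col_stabilizer \<omega>. if \<tau> = u \<circ> v then of_int (sign v) else 0)"
  by (simp add: young_symmetrizer_def sum_fun_apply ga_scale_def ga_unit_def
      if_distrib[of "\<lambda>x. _ * x"] cong: if_cong)

lemma finite_row_stabilizer: "finite (row_stabilizer \<omega>)"
  and finite_col_stabilizer: "finite (col_stabilizer \<omega>)"
  by (auto intro!: finite_subset[OF _ finite_perms[of "sum_list \<omega>"]]
      dest: row_stabilizer_perms col_stabilizer_perms)

lemma young_symmetrizer_equivariant: "young_equivariant \<omega> (young_symmetrizer \<omega>)"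
  unfolding young_equivariant_def
proof (intro conjI ballI allI impI)
  fix u0 \<tau> assume u0: "u0 \<in> row_stabilizer \<omega>"
  show "young_symmetrizer \<omega> (u0 \<circ> \<tau>) = young_symmetrizer \<omega> \<tau>"
    unfolding young_symmetrizer_apply
  proof (rule sum.reindex_bij_witness[where i = "\<lambda>u. u0 \<circ> u" and j = "\<lambda>u. inv u0 \<circ> u"])
    fix u assume u: "u \<in> row_stabilizer \<omega>"
    have "\<tau> = inv u0 \<circ> u \<circ> v \<longleftrightarrow> u0 \<circ> \<tau> = u \<circ> v" for v
      using row_stabilizer_bij[OF u0] by (metis inv_comp_cancel(1,2) o_assoc)
    then show "(\<Sum>v\<in>col_stabilizer \<omega>. if \<tau> = inv u0 \<circ> u \<circ> v then of_int (sign v) else 0) =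
      (\<Sum>v\<in>col_stabilizer \<omega>. if u0 \<circ> \<tau> = u \<circ> v then of_int (sign v) else (0::complex))" by simp
  qed (use u0 in \<open>auto simp: row_stabilizer_comp row_stabilizer_inv inv_comp_cancel row_stabilizer_bij\<close>)
next
  fix v0 \<tau> assume v0: "v0 \<in> col_stabilizer \<omega>"
  have perm: "permutation v" if "v \<in> col_stabilizer \<omega>" for v
    using col_stabilizer_perms[OF that] by (rule perms_permutation)
  show "young_symmetrizer \<omega> (\<tau> \<circ> v0) = of_int (sign v0) * young_symmetrizer \<omega> \<tau>"
    unfolding young_symmetrizer_apply sum_distrib_left
  proof (rule sum.cong[OF refl],
      rule sum.reindex_bij_witness[where i = "\<lambda>v. v \<circ> v0" and j = "\<lambda>v. v \<circ> inv v0"])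
    fix u v assume v: "v \<in> col_stabilizer \<omega>"
    have "\<tau> = u \<circ> (v \<circ> inv v0) \<longleftrightarrow> \<tau> \<circ> v0 = u \<circ> v"
      using inv_comp_cancel(3,4)[OF col_stabilizer_bij[OF v0]]
      by (metis comp_id o_assoc)
    moreover have "sign v0 * sign (v \<circ> inv v0) = sign v"
      using perm[OF v] perm[OF v0] by (simp add: sign_compose sign_inverse permutation_inverse)
    then have "(of_int (sign v0) * of_int (sign (v \<circ> inv v0)) :: complex) = of_int (sign v)"
      by (metis of_int_mult)
    ultimately show "of_int (sign v0) *
       (if \<tau> = u \<circ> (v \<circ> inv v0) then of_int (sign (v \<circ> inv v0)) else 0) =
      (if \<tau> \<circ> v0 = u \<circ> v then of_int (sign v) else (0::complex))" by simp
  qed (use v0 in \<open>auto simp: col_stabilizer_comp col_stabilizer_inv inv_comp_cancel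
      col_stabilizer_bij comp_assoc\<close>)
next
  fix \<tau> assume "\<tau> \<notin> perms (sum_list \<omega>)"
  then have "\<tau> \<noteq> u \<circ> v" if "u \<in> row_stabilizer \<omega>" "v \<in> col_stabilizer \<omega>" for u v
    using that perms_comp row_stabilizer_perms col_stabilizer_perms by blast
  then show "young_symmetrizer \<omega> \<tau> = 0"
    unfolding young_symmetrizer_apply by (intro sum.neutral ballI) auto
qed

text \<open>If a row and a column permutation compose to \<open>id\<close>, they are mutually
  inverse and lie in both stabilizers, so only the trivial pair contributes.\<close>

lemma young_symmetrizer_id: "young_symmetrizer \<omega> id = 1"
proof -
  have *: "id = u \<circ> v \<longleftrightarrow> u = id \<and> v = id"
    if u: "u \<in> row_stabilizer \<omega>" and v: "v \<in> col_stabilizer \<omega>" for u v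
  proof
    assume "id = u \<circ> v"
    then have "inv u = v" using inv_comp_cancel(1)[OF row_stabilizer_bij[OF u], of v] by simp
    then have "v = id" using row_stabilizer_inv[OF u] v by (intro stabilizers_disjoint) auto
    with \<open>id = u \<circ> v\<close> show "u = id \<and> v = id" by simp
  qed auto
  have "young_symmetrizer \<omega> id = (\<Sum>u\<in>row_stabilizer \<omega>. \<Sum>v\<in>col_stabilizer \<omega>.
      if u = id then if v = id then 1 else 0 else 0)"
    unfolding young_symmetrizer_apply by (intro sum.cong refl) (use * in auto)
  also have "\<dots> = (\<Sum>u\<in>row_stabilizer \<omega>. if u = id then 1 else 0)"
    using col_stabilizer_id[of \<omega>] finite_col_stabilizer[of \<omega>] by (intro sum.cong) auto
  also have "\<dots> = 1" using row_stabilizer_id[of \<omega>] finite_row_stabilizer[of \<omega>] by simp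
  finally show ?thesis .
qed

text \<open>Row permutations are absorbed by the left factor, and column permutations produce their
  sign in the right factor.\<close>

lemma young_symmetrizer_conv_equivariant:
  fixes \<omega>
  defines "c \<equiv> young_symmetrizer \<omega>" and "n \<equiv> sum_list \<omega>"
  shows "young_equivariant \<omega> (conv n c c)"
proof -
  have c: "young_equivariant \<omega> c" unfolding c_def by (rule young_symmetrizer_equivariant)
  show ?thesis unfolding young_equivariant_def
  proof (intro conjI ballI allI impI)
    fix u \<tau> assume u: "u \<in> row_stabilizer \<omega>"
    have inv: "inv (inv u) = u" using u by (simp add: inv_inv_eq row_stabilizer_bij)
    have "conv n c c (u \<circ> \<tau>) = left_mult (inv u) (conv n c c) \<tau>" by (simp add: left_mult_def inv)
    also have "\<dots> = conv n (left_mult (inv u) c) c \<tau>"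
      using row_stabilizer_perms[OF row_stabilizer_inv[OF u]] by (simp add: conv_left_mult n_def)
    also have "left_mult (inv u) c = c"
      using c u by (auto simp: left_mult_def inv young_equivariant_def fun_eq_iff)
    finally show "conv n c c (u \<circ> \<tau>) = conv n c c \<tau>" .
  next
    fix v and \<tau> :: "nat \<Rightarrow> nat" assume v: "v \<in> col_stabilizer \<omega>"
    have "c (inv \<sigma> \<circ> (\<tau> \<circ> v)) = of_int (sign v) * c (inv \<sigma> \<circ> \<tau>)" for \<sigma>
      using c v unfolding young_equivariant_def o_assoc by blast
    then show "conv n c c (\<tau> \<circ> v) = of_int (sign v) * conv n c c \<tau>"
      by (simp add: conv_def sum_distrib_left mult.left_commute)
  next
    fix \<tau> assume \<tau>: "\<tau> \<notin> perms (sum_list \<omega>)"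
    have "inv \<sigma> \<circ> \<tau> \<notin> perms n" if "\<sigma> \<in> perms n" for \<sigma>
      using perms_comp[OF that, of "inv \<sigma> \<circ> \<tau>"] \<tau> inv_comp_cancel(2)[OF perms_bij[OF that], of \<tau>]
      unfolding n_def by metis
    then show "conv n c c \<tau> = 0" 
      using c unfolding conv_def young_equivariant_def n_def by (intro sum.neutral ballI) auto
  qed
qed

text \<open>Each character times \<open>\<kappa>\<close> is a sum over conjugates. At
  \<open>id\<close> every term is 1, so that sum is the order of the group.\<close>

theorem irr_char_ratio:
  assumes "\<sigma> \<in> perms (sum_list \<omega>)"
  shows "irr_char \<omega> \<sigma> / irr_char \<omega> id =
    (\<Sum>g\<in>perms (sum_list \<omega>). young_symmetrizer \<omega> (inv g \<circ> inv \<sigma> \<circ> g)) / fact (sum_list \<omega>)"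
proof -
  let ?c = "young_symmetrizer \<omega>" and ?n = "sum_list \<omega>"
  define \<kappa> where "\<kappa> = conv ?n ?c ?c id"
  have idem: "conv ?n ?c ?c = ga_scale \<kappa> ?c"
  proof
    fix \<tau>
    show "conv ?n ?c ?c \<tau> = ga_scale \<kappa> ?c \<tau>"
      using young_equivariant_unique[OF young_symmetrizer_conv_equivariant
          young_symmetrizer_equivariant, of \<omega> \<tau>]
      unfolding ga_scale_def young_symmetrizer_id \<kappa>_def by (simp only: mult_1_right)
  qed
  have supp: "\<forall>\<tau>. \<tau> \<notin> perms ?n \<longrightarrow> ?c \<tau> = 0"
    using young_symmetrizer_equivariant unfolding young_equivariant_def by blast
  note tr = trace_on_left_ideal[OF supp idem young_symmetrizer_id]
  note nz = tr(1)
  have char: "\<kappa> * irr_char \<omega> \<sigma> = (\<Sum>g\<in>perms ?n. ?c (inv g \<circ> inv \<sigma> \<circ> g))" if "\<sigma> \<in> perms ?n" for \<sigma>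
    using tr(2)[OF that] by (simp only: irr_char_def specht_module_def)
  have "\<kappa> * irr_char \<omega> id = (\<Sum>g\<in>perms ?n. 1)"
    by (subst char) (auto simp: permutes_id inv_comp_cancel permutes_bij young_symmetrizer_id intro!: sum.cong)
  also have "\<dots> = fact ?n" by (simp add: card_permutations[of _ ?n])
  finally have "irr_char \<omega> id = fact ?n / \<kappa>" using nz by (simp add: field_simps)
  moreover have "irr_char \<omega> \<sigma> = (\<Sum>g\<in>perms ?n. ?c (inv g \<circ> inv \<sigma> \<circ> g)) / \<kappa>"
    using char[OF assms] nz by (simp add: field_simps)
  ultimately show ?thesis using nz by simp
qed

section \<open>Characters as sums over factorizations\<close>

text \<open>The row factor determines the column factor. Summing over all of \<open>perms\<close>
  with a condition, instead of over the stabilizer, gives an index set that conjugation maps to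
  itself.\<close>

lemma young_symmetrizer_sum_perms:
  assumes \<tau>: "\<tau> \<in> perms (sum_list \<omega>)"
  shows "young_symmetrizer \<omega> \<tau> = (\<Sum>u\<in>perms (sum_list \<omega>).
    if u \<in> row_stabilizer \<omega> \<and> inv u \<circ> \<tau> \<in> col_stabilizer \<omega> then of_int (sign (inv u \<circ> \<tau>)) else 0)"
proof -
  have "young_symmetrizer \<omega> \<tau> = (\<Sum>u\<in>row_stabilizer \<omega>.
      if inv u \<circ> \<tau> \<in> col_stabilizer \<omega> then of_int (sign (inv u \<circ> \<tau>)) else 0)"
    unfolding young_symmetrizer_apply
  proof (rule sum.cong[OF refl])
    fix u assume u: "u \<in> row_stabilizer \<omega>"
    have "\<tau> = u \<circ> v \<longleftrightarrow> v = inv u \<circ> \<tau>" for v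
      using row_stabilizer_bij[OF u] by (metis inv_comp_cancel(1,2))
    then have "(\<Sum>v\<in>col_stabilizer \<omega>. if \<tau> = u \<circ> v then of_int (sign v) else 0) =
        (\<Sum>v\<in>col_stabilizer \<omega>. if v = inv u \<circ> \<tau> then of_int (sign v) else (0::complex))"
      by (intro sum.cong refl) simp
    also have "\<dots> = (if inv u \<circ> \<tau> \<in> col_stabilizer \<omega> then of_int (sign (inv u \<circ> \<tau>)) else 0)"
      using finite_col_stabilizer[of \<omega>] by simp
    finally show "(\<Sum>v\<in>col_stabilizer \<omega>. if \<tau> = u \<circ> v then of_int (sign v) else 0) =
        (if inv u \<circ> \<tau> \<in> col_stabilizer \<omega> then of_int (sign (inv u \<circ> \<tau>)) else (0::complex))" .
  qed
  also have "\<dots> = (\<Sum>u\<in>perms (sum_list \<omega>).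
    if u \<in> row_stabilizer \<omega> \<and> inv u \<circ> \<tau> \<in> col_stabilizer \<omega> then of_int (sign (inv u \<circ> \<tau>)) else 0)"
    using finite_perms[of "sum_list \<omega>"] row_stabilizer_perms
    by (intro sum.mono_neutral_cong_left) auto
  finally show ?thesis .
qed

text \<open>\<open>r x\<close> and \<open>c x\<close> are the row and the column of the box that contains \<open>x\<close>; \<open>\<rho>\<close> is
  factored as \<open>\<sigma>\<close> times \<open>inv \<sigma> \<circ> \<rho>\<close>.\<close>

definition factorization_sum :: "nat \<Rightarrow> (nat \<Rightarrow> nat) \<Rightarrow> (nat \<Rightarrow> nat) \<Rightarrow> (nat \<Rightarrow> nat) \<Rightarrow> complex" where
  "factorization_sum N \<rho> r c = (\<Sum>\<sigma>\<in>perms N.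
     if (\<forall>x<N. r (\<sigma> x) = r x) \<and> (\<forall>x<N. c ((inv \<sigma> \<circ> \<rho>) x) = c x)
     then of_int (sign (inv \<sigma> \<circ> \<rho>)) else 0)"

lemma all_less_permute:
  assumes "g permutes {..<n::nat}"
  shows "(\<forall>x<n. S (g x)) \<longleftrightarrow> (\<forall>x<n. S x)"
  by (metis assms permutes_inv permutes_inverses(1) permutes_less)

lemma sign_conjugate:
  assumes "permutation g" "permutation v"
  shows "sign (inv g \<circ> v \<circ> g) = sign v"
  using assms by (simp add: sign_compose sign_inverse permutation_compose permutation_inverse)

text \<open>Conjugating both factors by \<open>g\<close> keeps the sign and moves \<open>g\<close>
  out of the permutations into the filling: afterwards \<open>inv g\<close> tells which box each
  entry occupies.\<close>

lemma young_symmetrizer_conjugate: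
  assumes g: "g \<in> perms (sum_list \<omega>)" and \<rho>: "\<rho> \<in> perms (sum_list \<omega>)"
  shows "young_symmetrizer \<omega> (inv g \<circ> \<rho> \<circ> g) =
    factorization_sum (sum_list \<omega>) \<rho> (box_row \<omega> \<circ> inv g) (box_col \<omega> \<circ> inv g)"
proof -
  let ?n = "sum_list \<omega>"
  have bg: "bij g" using g by (rule perms_bij)
  have gp: "g permutes {..<?n}" using g by simp
  have perm: "permutation \<sigma>" if "\<sigma> \<in> perms ?n" for \<sigma> using that by (rule perms_permutation)
  have "young_symmetrizer \<omega> (inv g \<circ> \<rho> \<circ> g) = (\<Sum>u\<in>perms ?n.
      if u \<in> row_stabilizer \<omega> \<and> inv u \<circ> (inv g \<circ> \<rho> \<circ> g) \<in> col_stabilizer \<omega>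
      then of_int (sign (inv u \<circ> (inv g \<circ> \<rho> \<circ> g))) else 0)"
    using g \<rho> by (intro young_symmetrizer_sum_perms) (simp add: permutes_compose permutes_inv)
  also have "\<dots> = factorization_sum ?n \<rho> (box_row \<omega> \<circ> inv g) (box_col \<omega> \<circ> inv g)"
    unfolding factorization_sum_def
  proof (rule sum.reindex_bij_witness[where i = "\<lambda>\<sigma>. inv g \<circ> \<sigma> \<circ> g" and j = "\<lambda>u. g \<circ> u \<circ> inv g"])
    fix u assume u: "u \<in> perms ?n"
    define \<sigma> where "\<sigma> = g \<circ> u \<circ> inv g"
    have \<sigma>: "\<sigma> \<in> perms ?n" using u g by (simp add: \<sigma>_def permutes_compose permutes_inv)
    have u_eq: "u = inv g \<circ> \<sigma> \<circ> g"
      using bg by (simp add: \<sigma>_def fun_eq_iff bij_is_inj inv_f_f)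
    have inv_u: "inv u \<circ> (inv g \<circ> \<rho> \<circ> g) = inv g \<circ> (inv \<sigma> \<circ> \<rho>) \<circ> g"
      unfolding u_eq using bg perms_bij[OF \<sigma>]
      by (simp add: o_inv_distrib bij_comp bij_imp_bij_inv inv_inv_eq fun_eq_iff bij_is_surj surj_f_inv_f)
    have "u \<in> row_stabilizer \<omega> \<longleftrightarrow> (\<forall>x<?n. box_row \<omega> (inv g (\<sigma> (g x))) = box_row \<omega> (inv g (g x)))"
      using u bg unfolding row_stabilizer_def by (simp add: u_eq bij_is_inj inv_f_f)
    also have "\<dots> \<longleftrightarrow> (\<forall>x<?n. box_row \<omega> (inv g (\<sigma> x)) = box_row \<omega> (inv g x))"
      by (rule all_less_permute[OF gp])
    finally have row: "u \<in> row_stabilizer \<omega> \<longleftrightarrow>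
      (\<forall>x<?n. (box_row \<omega> \<circ> inv g) (\<sigma> x) = (box_row \<omega> \<circ> inv g) x)" by simp
    have "inv g \<circ> (inv \<sigma> \<circ> \<rho>) \<circ> g \<in> perms ?n"
      using g \<sigma> \<rho> by (simp add: permutes_compose permutes_inv)
    then have "inv g \<circ> (inv \<sigma> \<circ> \<rho>) \<circ> g \<in> col_stabilizer \<omega> \<longleftrightarrow>
        (\<forall>x<?n. box_col \<omega> (inv g ((inv \<sigma> \<circ> \<rho>) (g x))) = box_col \<omega> (inv g (g x)))"
      using bg by (simp add: col_stabilizer_def bij_is_inj inv_f_f)
    also have "\<dots> \<longleftrightarrow> (\<forall>x<?n. box_col \<omega> (inv g ((inv \<sigma> \<circ> \<rho>) x)) = box_col \<omega> (inv g x))"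
      by (rule all_less_permute[OF gp])
    finally have col: "inv g \<circ> (inv \<sigma> \<circ> \<rho>) \<circ> g \<in> col_stabilizer \<omega> \<longleftrightarrow>
      (\<forall>x<?n. (box_col \<omega> \<circ> inv g) ((inv \<sigma> \<circ> \<rho>) x) = (box_col \<omega> \<circ> inv g) x)" by simp
    have sgn: "sign (inv g \<circ> (inv \<sigma> \<circ> \<rho>) \<circ> g) = sign (inv \<sigma> \<circ> \<rho>)"
      by (intro sign_conjugate perm g permutation_compose permutation_inverse \<sigma> \<rho>)
    show "(if (\<forall>x<?n. (box_row \<omega> \<circ> inv g) ((g \<circ> u \<circ> inv g) x) = (box_row \<omega> \<circ> inv g) x) \<and>
        (\<forall>x<?n. (box_col \<omega> \<circ> inv g) ((inv (g \<circ> u \<circ> inv g) \<circ> \<rho>) x) = (box_col \<omega> \<circ> inv g) x)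
        then of_int (sign (inv (g \<circ> u \<circ> inv g) \<circ> \<rho>)) else (0::complex)) =
      (if u \<in> row_stabilizer \<omega> \<and> inv u \<circ> (inv g \<circ> \<rho> \<circ> g) \<in> col_stabilizer \<omega>
        then of_int (sign (inv u \<circ> (inv g \<circ> \<rho> \<circ> g))) else 0)"
      unfolding inv_u sgn row col \<sigma>_def[symmetric] ..
  qed (use g bg in \<open>auto simp: permutes_compose permutes_inv fun_eq_iff bij_is_inj inv_f_f
      bij_is_surj surj_f_inv_f\<close>)
  finally show ?thesis .
qed

lemma factorization_sum_cong:
  assumes "\<rho> \<in> perms N" "\<And>x. x < N \<Longrightarrow> r x = r' x" "\<And>x. x < N \<Longrightarrow> c x = c' x"
  shows "factorization_sum N \<rho> r c = factorization_sum N \<rho> r' c'"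
  unfolding factorization_sum_def
proof (rule sum.cong[OF refl])
  fix \<sigma> assume \<sigma>: "\<sigma> \<in> perms N"
  have "\<sigma> x < N" "(inv \<sigma> \<circ> \<rho>) x < N" if "x < N" for x
    using that \<sigma> assms(1) by (auto simp: permutes_less permutes_inv)
  then have "(\<forall>x<N. r (\<sigma> x) = r x) \<longleftrightarrow> (\<forall>x<N. r' (\<sigma> x) = r' x)"
    "(\<forall>x<N. c ((inv \<sigma> \<circ> \<rho>) x) = c x) \<longleftrightarrow> (\<forall>x<N. c' ((inv \<sigma> \<circ> \<rho>) x) = c' x)"
    using assms(2,3) by (metis (no_types, lifting))+
  then show "(if (\<forall>x<N. r (\<sigma> x) = r x) \<and> (\<forall>x<N. c ((inv \<sigma> \<circ> \<rho>) x) = c x)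
     then of_int (sign (inv \<sigma> \<circ> \<rho>)) else 0) =
    (if (\<forall>x<N. r' (\<sigma> x) = r' x) \<and> (\<forall>x<N. c' ((inv \<sigma> \<circ> \<rho>) x) = c' x)
     then of_int (sign (inv \<sigma> \<circ> \<rho>)) else (0::complex))" by simp
qed

text \<open>A point fixed by \<open>\<rho>\<close> and its image under a contributing \<open>inv \<sigma>\<close> lie in the same box.\<close>

lemma factorization_sum_restrict:
  assumes \<rho>: "\<rho> \<in> perms k" and kN: "k \<le> N"
    and inj: "inj_on (\<lambda>x. (r x, c x)) {..<N}"
  shows "factorization_sum N \<rho> r c = factorization_sum k \<rho> r c"
  unfolding factorization_sum_def
proof (rule sum.mono_neutral_cong_right)
  have sub: "{..<k} \<subseteq> {..<N}" using kN by auto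
  show "finite (perms N)" by (rule finite_perms)
  show "perms k \<subseteq> perms N" using permutes_subset[OF _ sub] by blast
  show "\<forall>\<sigma>\<in>perms N - perms k. (if (\<forall>x<N. r (\<sigma> x) = r x) \<and>
      (\<forall>x<N. c ((inv \<sigma> \<circ> \<rho>) x) = c x) then of_int (sign (inv \<sigma> \<circ> \<rho>)) else (0::complex)) = 0"
  proof
    fix \<sigma> assume \<sigma>: "\<sigma> \<in> perms N - perms k"
    then have \<sigma>N: "\<sigma> permutes {..<N}" by simp
    have False if r: "\<forall>x<N. r (\<sigma> x) = r x" and c: "\<forall>x<N. c ((inv \<sigma> \<circ> \<rho>) x) = c x"
    proof -
      have "\<sigma> x = x" if x: "x \<notin> {..<k}" for x
      proof (cases "x < N")
        case True
        let ?y = "inv \<sigma> x"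
        have y: "?y < N" using True \<sigma>N by (simp add: permutes_less permutes_inv)
        have "r ?y = r x" using r[rule_format, OF y] \<sigma>N by (simp add: permutes_inverses)
        moreover have "\<rho> x = x" using \<rho> x by (simp add: permutes_not_in)
        then have "c ?y = c x" using c True by auto
        ultimately have "?y = x" using inj y True by (auto simp: inj_on_def)
        then show ?thesis using \<sigma>N by (metis permutes_inverses(1))
      next
        case False
        then show ?thesis using \<sigma>N by (simp add: permutes_not_in)
      qed
      then have "\<sigma> permutes {..<k}" using \<sigma>N permutes_superset by (metis Diff_iff)
      then show False using \<sigma> by simp
    qed
    then show "(if (\<forall>x<N. r (\<sigma> x) = r x) \<and> (\<forall>x<N. c ((inv \<sigma> \<circ> \<rho>) x) = c x)
      then of_int (sign (inv \<sigma> \<circ> \<rho>)) else (0::complex)) = 0" by auto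
  qed
  fix \<sigma> assume \<sigma>: "\<sigma> \<in> perms k"
  \<comment> \<open>For a surviving \<open>\<sigma>\<close> the conditions at points from
    \<open>k\<close> on hold trivially, so only those below \<open>k\<close> remain.\<close>
  have "\<sigma> x = x" "(inv \<sigma> \<circ> \<rho>) x = x" if "\<not> x < k" for x
    using that \<sigma> \<rho> permutes_inv[of \<sigma> "{..<k}"] by (simp_all add: permutes_not_in)
  then have "(\<forall>x<N. r (\<sigma> x) = r x) \<longleftrightarrow> (\<forall>x<k. r (\<sigma> x) = r x)"
    "(\<forall>x<N. c ((inv \<sigma> \<circ> \<rho>) x) = c x) \<longleftrightarrow> (\<forall>x<k. c ((inv \<sigma> \<circ> \<rho>) x) = c x)"
    using kN by (metis order_less_le_trans)+
  then show "(if (\<forall>x<N. r (\<sigma> x) = r x) \<and> (\<forall>x<N. c ((inv \<sigma> \<circ> \<rho>) x) = c x)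
      then of_int (sign (inv \<sigma> \<circ> \<rho>)) else (0::complex)) =
    (if (\<forall>x<k. r (\<sigma> x) = r x) \<and> (\<forall>x<k. c ((inv \<sigma> \<circ> \<rho>) x) = c x)
      then of_int (sign (inv \<sigma> \<circ> \<rho>)) else 0)" by simp
qed

text \<open>Two points in the same box: multiplying \<open>\<sigma>\<close> by their transposition reverses the sign.\<close>

lemma factorization_sum_not_inj:
  assumes \<rho>: "\<rho> \<in> perms N" and ninj: "\<not> inj_on (\<lambda>x. (r x, c x)) {..<N}"
  shows "factorization_sum N \<rho> r c = 0"
proof -
  obtain a b where ab: "a < N" "b < N" "a \<noteq> b" "r a = r b" "c a = c b"
    using ninj by (auto simp: inj_on_def)
  let ?t = "Transposition.transpose a b"
  have t: "?t permutes {..<N}" using ab by (intro permutes_swap_id) auto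
  have rt: "r (?t x) = r x" and ct: "c (?t x) = c x" for x
    using ab by (auto simp: Transposition.transpose_def)
  define S where "S \<sigma> = (if (\<forall>x<N. r (\<sigma> x) = r x) \<and> (\<forall>x<N. c ((inv \<sigma> \<circ> \<rho>) x) = c x)
     then of_int (sign (inv \<sigma> \<circ> \<rho>)) else (0::complex))" for \<sigma>
  have "S (\<sigma> \<circ> ?t) = - S \<sigma>" if \<sigma>: "\<sigma> \<in> perms N" for \<sigma>
  proof -
    have inv: "inv (\<sigma> \<circ> ?t) \<circ> \<rho> = ?t \<circ> (inv \<sigma> \<circ> \<rho>)"
      using perms_bij[OF \<sigma>] by (simp add: o_inv_distrib o_assoc)
    have "permutation (inv \<sigma> \<circ> \<rho>)"
      using \<sigma> \<rho> perms_permutation by (intro permutation_compose permutation_inverse) blast+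
    then have sgn: "sign (?t \<circ> (inv \<sigma> \<circ> \<rho>)) = - sign (inv \<sigma> \<circ> \<rho>)"
      using ab(3) by (simp add: sign_compose permutation_swap_id sign_swap_id)
    have "(\<forall>x<N. r ((\<sigma> \<circ> ?t) x) = r x) \<longleftrightarrow> (\<forall>x<N. r (\<sigma> (?t x)) = r (?t x))" by (simp add: rt)
    also have "\<dots> \<longleftrightarrow> (\<forall>x<N. r (\<sigma> x) = r x)" by (rule all_less_permute[OF t])
    finally have "(\<forall>x<N. r ((\<sigma> \<circ> ?t) x) = r x) \<longleftrightarrow> (\<forall>x<N. r (\<sigma> x) = r x)" .
    then show ?thesis unfolding S_def inv sgn by (simp add: ct)
  qed
  then have "(\<Sum>\<sigma>\<in>perms N. S (\<sigma> \<circ> ?t)) = (\<Sum>\<sigma>\<in>perms N. - S \<sigma>)" by (intro sum.cong refl)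
  moreover have "(\<Sum>\<sigma>\<in>perms N. S \<sigma>) = (\<Sum>\<sigma>\<in>perms N. S (\<sigma> \<circ> ?t))"
    by (rule sum_permutations_compose_right[OF t])
  ultimately have "(\<Sum>\<sigma>\<in>perms N. S \<sigma>) = 0" by (simp add: sum_negf)
  then show ?thesis by (simp add: factorization_sum_def S_def)
qed

section \<open>From bijective fillings to arbitrary maps\<close>

lemma extend_injection_to_permutation:
  assumes f: "f \<in> {..<k} \<rightarrow>\<^sub>E {..<n::nat}" "inj_on f {..<k}" and kn: "k \<le> n"
  obtains g where "g permutes {..<n}" "restrict g {..<k} = f"
proof -
  have sub: "f ` {..<k} \<subseteq> {..<n}" using f by auto
  have "card ({..<n} - f ` {..<k}) = card {k..<n}"
    using sub f by (simp add: card_Diff_subset card_image)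
  then obtain h where h: "bij_betw h {k..<n} ({..<n} - f ` {..<k})"
    by (metis finite_same_card_bij finite_atLeastLessThan finite_Diff finite_lessThan)
  define g where "g x = (if x < k then f x else if x < n then h x else x)" for x
  have "bij_betw g {..<k} (f ` {..<k})"
    using f(2) by (auto simp: g_def bij_betw_def inj_on_def)
  moreover have "bij_betw g {k..<n} ({..<n} - f ` {..<k})"
    using h by (rule bij_betw_cong[THEN iffD1, rotated]) (simp add: g_def)
  ultimately have "bij_betw g ({..<k} \<union> {k..<n}) (f ` {..<k} \<union> ({..<n} - f ` {..<k}))"
    by (rule bij_betw_combine) auto
  moreover have "{..<k} \<union> {k..<n} = {..<n}" using kn by auto
  moreover have "f ` {..<k} \<union> ({..<n} - f ` {..<k}) = {..<n}" using sub by auto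
  ultimately have "bij_betw g {..<n} {..<n}" by simp
  then have "g permutes {..<n}" using kn by (intro bij_imp_permutes) (auto simp: g_def)
  moreover have "restrict g {..<k} = f"
    using f(1) by (auto simp: fun_eq_iff g_def restrict_def PiE_def extensional_def)
  ultimately show thesis by (rule that)
qed

text \<open>The extensions form a coset: they differ from a fixed one by a permutation of the points
  from \<open>k\<close> on.\<close>

lemma card_extensions_to_permutation:
  assumes f: "f \<in> {..<k} \<rightarrow>\<^sub>E {..<n::nat}" "inj_on f {..<k}" and kn: "k \<le> n"
  shows "card {g \<in> perms n. restrict g {..<k} = f} = fact (n - k)"
proof -
  obtain g0 where g0: "g0 permutes {..<n}" "restrict g0 {..<k} = f"
    using extend_injection_to_permutation[OF f kn] .
  have b0: "bij g0" using g0 by (simp add: permutes_bij)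
  have "bij_betw (\<lambda>\<tau>. g0 \<circ> \<tau>) {\<tau>. \<tau> permutes {k..<n}} {g \<in> perms n. restrict g {..<k} = f}"
  proof (rule bij_betw_byWitness[where f' = "\<lambda>g. inv g0 \<circ> g"])
    show "\<forall>\<tau>\<in>{\<tau>. \<tau> permutes {k..<n}}. inv g0 \<circ> (g0 \<circ> \<tau>) = \<tau>"
      "\<forall>g\<in>{g \<in> perms n. restrict g {..<k} = f}. g0 \<circ> (inv g0 \<circ> g) = g"
      using b0 by (simp_all add: inv_comp_cancel)
    show "(\<lambda>\<tau>. g0 \<circ> \<tau>) ` {\<tau>. \<tau> permutes {k..<n}} \<subseteq> {g \<in> perms n. restrict g {..<k} = f}"
    proof safe
      fix \<tau> assume \<tau>: "\<tau> permutes {k..<n}"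
      then have "\<tau> permutes {..<n}" by (rule permutes_subset) auto
      then show "g0 \<circ> \<tau> permutes {..<n}" using g0(1) by (simp add: permutes_compose)
      have "restrict (g0 \<circ> \<tau>) {..<k} = restrict g0 {..<k}"
        using \<tau> by (auto simp: fun_eq_iff restrict_def permutes_not_in)
      then show "restrict (g0 \<circ> \<tau>) {..<k} = f" using g0(2) by simp
    qed
    show "(\<lambda>g. inv g0 \<circ> g) ` {g \<in> perms n. restrict g {..<k} = f} \<subseteq> {\<tau>. \<tau> permutes {k..<n}}"
    proof safe
      fix g assume g: "g permutes {..<n}" "f = restrict g {..<k}"
      have "inv g0 \<circ> g permutes {..<n}" using g g0 by (simp add: permutes_compose permutes_inv)
      moreover have "(inv g0 \<circ> g) x = x" if "x \<in> {..<n} - {k..<n}" for x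
      proof -
        have "g x = g0 x" using that g(2) g0(2) by (metis Diff_iff atLeastLessThan_iff lessThan_iff not_le restrict_apply)
        then show ?thesis using b0 by (simp add: bij_is_inj inv_f_f)
      qed
      ultimately show "inv g0 \<circ> g permutes {k..<n}" by (rule permutes_superset)
    qed
  qed
  then have "card {g \<in> perms n. restrict g {..<k} = f} = card {\<tau>. \<tau> permutes {k..<n}}"
    by (rule bij_betw_same_card[symmetric])
  also have "\<dots> = fact (n - k)" by (rule card_permutations) auto
  finally show ?thesis .
qed

lemma sum_perms_restrict:
  fixes G :: "(nat \<Rightarrow> nat) \<Rightarrow> complex"
  assumes kn: "k \<le> n"
  shows "(\<Sum>g\<in>perms n. G (restrict g {..<k})) =
    fact (n - k) * (\<Sum>f\<in>{f \<in> {..<k} \<rightarrow>\<^sub>E {..<n}. inj_on f {..<k}}. G f)"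
proof -
  let ?I = "{f \<in> {..<k} \<rightarrow>\<^sub>E {..<n}. inj_on f {..<k}}"
  have fin: "finite ?I" by (simp add: finite_PiE)
  have "restrict g {..<k} \<in> ?I" if "g \<in> perms n" for g
    using that kn permutes_less[of g n] permutes_inj_on[of g "{..<n}" "{..<k}"]
    by (auto simp: inj_on_def)
  then have "(\<Sum>g\<in>perms n. G (restrict g {..<k})) =
      (\<Sum>f\<in>?I. \<Sum>g\<in>{g \<in> perms n. restrict g {..<k} = f}. G (restrict g {..<k}))"
    by (intro sum.group[symmetric] finite_perms fin) blast
  also have "\<dots> = (\<Sum>f\<in>?I. fact (n - k) * G f)"
  proof (rule sum.cong[OF refl])
    fix f assume f: "f \<in> ?I"
    have "(\<Sum>g\<in>{g \<in> perms n. restrict g {..<k} = f}. G (restrict g {..<k})) =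
        (\<Sum>g\<in>{g \<in> perms n. restrict g {..<k} = f}. G f)" by (intro sum.cong) auto
    also have "\<dots> = fact (n - k) * G f"
    proof -
      have "card {g \<in> perms n. restrict g {..<k} = f} = fact (n - k)"
        by (rule card_extensions_to_permutation) (use f kn in auto)
      then show ?thesis by (simp del: mem_Collect_eq)
    qed
    finally show "(\<Sum>g\<in>{g \<in> perms n. restrict g {..<k} = f}. G (restrict g {..<k})) =
        fact (n - k) * G f" .
  qed
  finally show ?thesis by (simp add: sum_distrib_left)
qed

lemma falling_prod_fact:
  "k \<le> n \<Longrightarrow> (\<Prod>i<k. of_nat (n - i)) * fact (n - k) = (fact n :: complex)"
proof (induction k)
  case (Suc k)
  then have "n - k = Suc (n - Suc k)" by simp
  then have "fact (n - k) = (of_nat (n - k) :: complex) * fact (n - Suc k)"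
    by (metis fact_Suc)
  then show ?case using Suc by (simp add: mult.assoc)
qed simp

text \<open>Every injective map has \<open>fact (n - k)\<close> extensions. Together with the
  falling factorial of the normalization this makes \<open>fact n\<close>, which cancels the average
  over the group. The remaining maps join the sum because they contribute 0.\<close>

theorem normalized_char_eq_factorization_sum:
  fixes \<omega> k
  defines "n \<equiv> sum_list \<omega>" and "\<rho> \<equiv> inv (cycle_of_list [0..<k])"
  assumes kn: "k \<le> n"
  shows "normalized_char \<omega> k =
    (\<Sum>f\<in>{..<k} \<rightarrow>\<^sub>E {..<n}. factorization_sum k \<rho> (box_row \<omega> \<circ> f) (box_col \<omega> \<circ> f))"
proof -
  let ?\<pi> = "cycle_of_list [0..<k]"
  let ?W = "\<lambda>N f. factorization_sum N \<rho> (box_row \<omega> \<circ> f) (box_col \<omega> \<circ> f)"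
  have "?\<pi> permutes set [0..<k]" by (rule cycle_permutes)
  then have \<pi>k: "?\<pi> \<in> perms k" by (simp add: atLeast0LessThan)
  have sub: "{..<k} \<subseteq> {..<n}" using kn by auto
  have \<pi>n: "?\<pi> \<in> perms n" using \<pi>k permutes_subset[OF _ sub] by simp
  have \<rho>k: "\<rho> \<in> perms k" and \<rho>n: "\<rho> \<in> perms n"
    using \<pi>k \<pi>n by (simp_all add: \<rho>_def permutes_inv)
  have inj_box: "inj_on (\<lambda>x. (box_row \<omega> x, box_col \<omega> x)) {..<n}"
    using bij_betw_boxes[of \<omega>] by (simp add: bij_betw_def n_def)
  have inj_iff: "inj_on (\<lambda>x. ((box_row \<omega> \<circ> f) x, (box_col \<omega> \<circ> f) x)) A \<longleftrightarrow> inj_on f A"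
    if "f ` A \<subseteq> {..<n}" for f :: "nat \<Rightarrow> nat" and A
  proof
    assume "inj_on f A"
    with inj_box that show "inj_on (\<lambda>x. ((box_row \<omega> \<circ> f) x, (box_col \<omega> \<circ> f) x)) A"
      by (intro inj_onI) (metis (no_types, lifting) Pair_inject comp_apply image_subset_iff inj_onD)
  qed (auto simp: inj_on_def)
  have "(\<Sum>g\<in>perms n. young_symmetrizer \<omega> (inv g \<circ> \<rho> \<circ> g)) = (\<Sum>g\<in>perms n. ?W n (inv g))"
    using \<rho>n by (intro sum.cong refl) (simp add: young_symmetrizer_conjugate n_def)
  also have "\<dots> = (\<Sum>g\<in>perms n. ?W n g)" by (rule sum_permutations_inverse[symmetric])
  also have "\<dots> = (\<Sum>g\<in>perms n. ?W k (restrict g {..<k}))"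
  proof (rule sum.cong[OF refl])
    fix g assume g: "g \<in> perms n"
    then have "inj_on g {..<n}" "g ` {..<n} \<subseteq> {..<n}"
      by (auto simp: permutes_inj_on permutes_less)
    then have "?W n g = ?W k g"
      by (intro factorization_sum_restrict[OF \<rho>k kn]) (simp only: inj_iff)
    also have "\<dots> = ?W k (restrict g {..<k})"
      by (intro factorization_sum_cong \<rho>k) auto
    finally show "?W n g = ?W k (restrict g {..<k})" .
  qed
  also have "\<dots> = fact (n - k) * (\<Sum>f\<in>{f \<in> {..<k} \<rightarrow>\<^sub>E {..<n}. inj_on f {..<k}}. ?W k f)"
    by (rule sum_perms_restrict[OF kn])
  also have "(\<Sum>f\<in>{f \<in> {..<k} \<rightarrow>\<^sub>E {..<n}. inj_on f {..<k}}. ?W k f) =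
      (\<Sum>f\<in>{..<k} \<rightarrow>\<^sub>E {..<n}. ?W k f)"
  proof (rule sum.mono_neutral_left)
    show "\<forall>f\<in>({..<k} \<rightarrow>\<^sub>E {..<n}) - {f \<in> {..<k} \<rightarrow>\<^sub>E {..<n}. inj_on f {..<k}}. ?W k f = 0"
    proof
      fix f assume f: "f \<in> ({..<k} \<rightarrow>\<^sub>E {..<n}) - {f \<in> {..<k} \<rightarrow>\<^sub>E {..<n}. inj_on f {..<k}}"
      then have "f ` {..<k} \<subseteq> {..<n}" "\<not> inj_on f {..<k}" by auto
      then show "?W k f = 0" by (intro factorization_sum_not_inj \<rho>k) (simp only: inj_iff not_False_eq_True)
    qed
  qed (auto simp: finite_PiE)
  finally have "(\<Sum>g\<in>perms n. young_symmetrizer \<omega> (inv g \<circ> \<rho> \<circ> g)) =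
      fact (n - k) * (\<Sum>f\<in>{..<k} \<rightarrow>\<^sub>E {..<n}. ?W k f)" .
  moreover have "normalized_char \<omega> k = (\<Prod>i<k. of_nat (n - i)) * (irr_char \<omega> ?\<pi> / irr_char \<omega> id)"
    by (simp add: normalized_char_def n_def)
  moreover have "irr_char \<omega> ?\<pi> / irr_char \<omega> id =
      (\<Sum>g\<in>perms n. young_symmetrizer \<omega> (inv g \<circ> \<rho> \<circ> g)) / fact n"
    using irr_char_ratio[of ?\<pi> \<omega>] \<pi>n by (simp add: n_def \<rho>_def)
  ultimately have "normalized_char \<omega> k =
      (\<Prod>i<k. of_nat (n - i)) * fact (n - k) / fact n * (\<Sum>f\<in>{..<k} \<rightarrow>\<^sub>E {..<n}. ?W k f)"
    by simp
  then show ?thesis by (simp add: falling_prod_fact[OF kn])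
qed

section \<open>Counting fillings by cycles\<close>

text \<open>The range may vary with the point because the columns available to an entry depend on
  its row. \<open>PiE\<close> fixes the values outside \<open>{..<N}\<close>, so that such functions
  can be counted.\<close>

definition invariant_fns :: "nat \<Rightarrow> (nat \<Rightarrow> nat) \<Rightarrow> (nat \<Rightarrow> nat set) \<Rightarrow> (nat \<Rightarrow> nat) set" where
  "invariant_fns N \<sigma> A = {r \<in> PiE {..<N} A. \<forall>x<N. r (\<sigma> x) = r x}"

lemma finite_invariant_fns:
  "(\<And>x. x < N \<Longrightarrow> finite (A x)) \<Longrightarrow> finite (invariant_fns N \<sigma> A)"
  unfolding invariant_fns_def by (rule finite_subset[OF _ finite_PiE[of "{..<N}" A]]) auto

lemma orbit_eq_of_mem:
  assumes "\<sigma> \<in> perms N" "y \<in> orbit \<sigma> x"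
  shows "orbit \<sigma> y = orbit \<sigma> x"
  using assms orbit_cyclic_eq3[OF cyclic_on_orbit[of \<sigma> "{..<N}" x]] by simp

lemma self_mem_orbit: "\<sigma> \<in> perms N \<Longrightarrow> x \<in> orbit \<sigma> x"
  by (intro permutation_self_in_orbit perms_permutation)

lemma orbit_less: "\<sigma> \<in> perms N \<Longrightarrow> x < N \<Longrightarrow> y \<in> orbit \<sigma> x \<Longrightarrow> y < N"
  using permutes_orbit_subset[of \<sigma> "{..<N}" x] by auto

lemma invariant_on_orbit:
  assumes "\<sigma> \<in> perms N" "\<forall>x<N. r (\<sigma> x) = r x" "x < N" "y \<in> orbit \<sigma> x"
  shows "r y = r x"
  using assms(4)
proof induction
  case base show ?case using assms by simp
next
  case (step y)
  then show ?case using assms orbit_less[OF assms(1,3)] by simp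
qed

text \<open>An invariant function is constant on each cycle, and its value there must be allowed at
  every point of the cycle. The values on different cycles are independent; \<open>SOME\<close>
  picks a representative at which to read them.\<close>

lemma card_invariant_fns:
  assumes \<sigma>: "\<sigma> \<in> perms N"
  shows "card (invariant_fns N \<sigma> A) = (\<Prod>X\<in>orbit \<sigma> ` {..<N}. card (\<Inter>x\<in>X. A x))"
proof -
  let ?O = "orbit \<sigma> ` {..<N}"
  have some: "(SOME x. x \<in> X) \<in> X" if "X \<in> ?O" for X
  proof -
    have "\<exists>x. x \<in> X" using that self_mem_orbit[OF \<sigma>] by blast
    then show ?thesis by (rule someI_ex)
  qed
  have Xeq: "orbit \<sigma> x = X" if "X \<in> ?O" "x \<in> X" for X x
    using that orbit_eq_of_mem[OF \<sigma>] by auto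
  have lt: "x < N" if "X \<in> ?O" "x \<in> X" for X x
    using that orbit_less[OF \<sigma>] by auto
  have "bij_betw (\<lambda>s. \<lambda>x\<in>{..<N}. s (orbit \<sigma> x)) (PiE ?O (\<lambda>X. \<Inter>x\<in>X. A x)) (invariant_fns N \<sigma> A)"
  proof (rule bij_betw_byWitness[where f' = "\<lambda>r. \<lambda>X\<in>?O. r (SOME x. x \<in> X)"])
    show "\<forall>s\<in>PiE ?O (\<lambda>X. \<Inter>x\<in>X. A x).
        (\<lambda>X\<in>?O. (\<lambda>x\<in>{..<N}. s (orbit \<sigma> x)) (SOME x. x \<in> X)) = s"
    proof
      fix s assume s: "s \<in> PiE ?O (\<lambda>X. \<Inter>x\<in>X. A x)"
      show "(\<lambda>X\<in>?O. (\<lambda>x\<in>{..<N}. s (orbit \<sigma> x)) (SOME x. x \<in> X)) = s"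
      proof
        fix X
        show "(\<lambda>X\<in>?O. (\<lambda>x\<in>{..<N}. s (orbit \<sigma> x)) (SOME x. x \<in> X)) X = s X"
        proof (cases "X \<in> ?O")
          case True
          then show ?thesis
            using lt[OF True some[OF True]] Xeq[OF True some[OF True]] by (simp add: restrict_apply)
        next
          case False
          then show ?thesis using s by (simp add: restrict_apply PiE_def extensional_def)
        qed
      qed
    qed
    show "\<forall>r\<in>invariant_fns N \<sigma> A. (\<lambda>x\<in>{..<N}. (\<lambda>X\<in>?O. r (SOME x. x \<in> X)) (orbit \<sigma> x)) = r"
    proof
      fix r assume r: "r \<in> invariant_fns N \<sigma> A"
      show "(\<lambda>x\<in>{..<N}. (\<lambda>X\<in>?O. r (SOME x. x \<in> X)) (orbit \<sigma> x)) = r"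
      proof
        fix x
        show "(\<lambda>x\<in>{..<N}. (\<lambda>X\<in>?O. r (SOME x. x \<in> X)) (orbit \<sigma> x)) x = r x"
        proof (cases "x < N")
          case True
          then have "orbit \<sigma> x \<in> ?O" by simp
          from some[OF this] have "r (SOME y. y \<in> orbit \<sigma> x) = r x"
            using r True by (intro invariant_on_orbit[OF \<sigma>]) (auto simp: invariant_fns_def)
          then show ?thesis using True by simp
        next
          case False
          then show ?thesis using r by (simp add: invariant_fns_def PiE_def extensional_def)
        qed
      qed
    qed
    show "(\<lambda>s. \<lambda>x\<in>{..<N}. s (orbit \<sigma> x)) ` PiE ?O (\<lambda>X. \<Inter>x\<in>X. A x) \<subseteq> invariant_fns N \<sigma> A"
    proof (rule image_subsetI)
      fix s assume s: "s \<in> PiE ?O (\<lambda>X. \<Inter>x\<in>X. A x)"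
      have "s (orbit \<sigma> x) \<in> A x" if "x < N" for x
        using PiE_mem[OF s, of "orbit \<sigma> x"] that self_mem_orbit[OF \<sigma>, of x] by auto
      moreover have "\<sigma> x < N \<and> orbit \<sigma> (\<sigma> x) = orbit \<sigma> x" if "x < N" for x
        using that \<sigma> by (auto simp: permutes_less permutation_orbit_step[OF perms_permutation[OF \<sigma>]])
      ultimately show "(\<lambda>x\<in>{..<N}. s (orbit \<sigma> x)) \<in> invariant_fns N \<sigma> A"
        by (auto simp: invariant_fns_def)
    qed
    show "(\<lambda>r. \<lambda>X\<in>?O. r (SOME x. x \<in> X)) ` invariant_fns N \<sigma> A \<subseteq> PiE ?O (\<lambda>X. \<Inter>x\<in>X. A x)"
    proof (rule image_subsetI, rule PiE_I)
      fix r X assume r: "r \<in> invariant_fns N \<sigma> A" and X: "X \<in> ?O"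
      have "r (SOME y. y \<in> X) \<in> A x" if x: "x \<in> X" for x
      proof -
        have xN: "x < N" using lt[OF X x] .
        have "(SOME y. y \<in> X) \<in> orbit \<sigma> x" using some[OF X] Xeq[OF X x] by simp
        then have "r (SOME y. y \<in> X) = r x"
          using r xN by (intro invariant_on_orbit[OF \<sigma>]) (auto simp: invariant_fns_def)
        then show ?thesis using r xN by (auto simp: invariant_fns_def)
      qed
      then show "(\<lambda>X\<in>?O. r (SOME x. x \<in> X)) X \<in> (\<Inter>x\<in>X. A x)" using X by simp
    qed simp
  qed
  then have "card (invariant_fns N \<sigma> A) = card (PiE ?O (\<lambda>X. \<Inter>x\<in>X. A x))"
    by (rule bij_betw_same_card[symmetric])
  then show ?thesis by (simp add: card_PiE)
qed

section \<open>Signs and numbers of cycles\<close>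

lemma sign_cycle_of_list:
  "distinct cs \<Longrightarrow> cs \<noteq> [] \<Longrightarrow> sign (cycle_of_list cs) = (-1) ^ (length cs - 1)"
proof (induction cs rule: cycle_of_list.induct)
  case (1 i j cs)
  then have "sign (cycle_of_list (i # j # cs)) =
      sign (Transposition.transpose i j) * sign (cycle_of_list (j # cs))"
    by (simp add: sign_compose permutation_swap_id permutation_of_cycle)
  also have "\<dots> = (-1) ^ (length (i # j # cs) - 1)" using 1 by (simp add: sign_swap_id)
  finally show ?case .
qed auto

lemma orbit_cycle_of_list:
  assumes cs: "distinct cs" and x: "x \<in> set cs"
  shows "orbit (cycle_of_list cs) x = set cs"
proof -
  let ?c = "cycle_of_list cs"
  have pow: "(?c ^^ n) (cs ! i) = cs ! ((i + n) mod length cs)" if "i < length cs" for i n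
  proof -
    have "(?c ^^ n) (cs ! i) = map (?c ^^ n) cs ! i" using that by simp
    also have "\<dots> = rotate n cs ! i" using cyclic_rotation[OF cs] by simp
    finally show ?thesis using that by (simp add: nth_rotate add.commute)
  qed
  obtain i where i: "i < length cs" "x = cs ! i" using x by (auto simp: in_set_conv_nth)
  have orb: "orbit ?c x = {(?c ^^ n) x | n. True}"
    by (rule orbit_altdef_permutation[OF permutation_of_cycle])
  have "y \<in> orbit ?c x" if "y \<in> set cs" for y
  proof -
    obtain j where j: "j < length cs" "y = cs ! j" using \<open>y \<in> set cs\<close> by (auto simp: in_set_conv_nth)
    \<comment> \<open>Going once more around the cycle avoids truncated subtraction when
      \<open>j < i\<close>.\<close>
    have "(i + (j + length cs - i)) mod length cs = j" using i j by simp
    then have "(?c ^^ (j + length cs - i)) x = y" using pow[OF i(1)] i j by simp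
    then show ?thesis unfolding orb by blast
  qed
  moreover have "orbit ?c x \<subseteq> set cs"
    by (rule permutes_orbit_subset[OF cycle_permutes x])
  ultimately show ?thesis by blast
qed

text \<open>On each of the two disjoint sets the composite agrees with one factor, so orbits are
  inherited. A nonempty cycle of length \<open>l\<close> contributes the sign
  \<open>(-1) ^ (l - 1)\<close>, one orbit and \<open>l\<close> points, which multiplies both sides
  by \<open>(-1) ^ l\<close>. Fixed points count as orbits.\<close>

lemma cycle_decomp_sign_orbits:
  assumes "cycle_decomp I p"
  shows "finite I \<and> p permutes I \<and> sign p * (-1) ^ card (orbit p ` I) = (-1) ^ card I"
  using assms
proof induction
  case empty
  then show ?case by (simp add: fun_eq_iff)
next
  case (comp I p cs)
  let ?c = "cycle_of_list cs"
  have dist: "distinct cs" and disj: "set cs \<inter> I = {}" using comp by auto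
  have finI: "finite I" and p: "p permutes I"
    and IH: "sign p * (-1) ^ card (orbit p ` I) = (-1) ^ card I" using comp by auto
  have c: "?c permutes set cs" by (rule cycle_permutes)
  have "?c permutes set cs \<union> I" "p permutes set cs \<union> I"
    using permutes_subset[OF c] permutes_subset[OF p] by auto
  then have perm: "?c \<circ> p permutes set cs \<union> I" by (simp add: permutes_compose)
  have orb1: "orbit (?c \<circ> p) x = set cs" if x: "x \<in> set cs" for x
  proof -
    have "orbit (?c \<circ> p) x = orbit ?c x"
    proof (rule orbit_cong0[OF x])
      have eq: "(?c \<circ> p) y = ?c y" if "y \<in> set cs" for y
      proof -
        have "y \<notin> I" using that disj by auto
        then show ?thesis using p by (simp add: permutes_not_in)
      qed
      then show "\<And>y. y \<in> set cs \<Longrightarrow> (?c \<circ> p) y = ?c y" .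
      show "?c \<circ> p \<in> set cs \<rightarrow> set cs"
        using eq permutes_in_image[OF c] by (auto simp del: comp_apply)
    qed
    then show ?thesis using orbit_cycle_of_list[OF dist x] by simp
  qed
  have orb2: "orbit (?c \<circ> p) x = orbit p x" if x: "x \<in> I" for x
  proof (rule orbit_cong0[OF x])
    have eq: "(?c \<circ> p) y = p y" if "y \<in> I" for y
      using that disj permutes_in_image[OF p, of y] by (auto intro!: id_outside_supp)
    then show "\<And>y. y \<in> I \<Longrightarrow> (?c \<circ> p) y = p y" .
    show "?c \<circ> p \<in> I \<rightarrow> I"
      using eq permutes_in_image[OF p] by (auto simp del: comp_apply)
  qed
  have sgn: "sign (?c \<circ> p) = sign ?c * sign p"
    using p finI by (intro sign_compose permutation_of_cycle) (auto simp: permutation_permutes)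
  show ?case
  proof (cases "cs = []")
    case True
    then show ?thesis using comp by simp
  next
    case False
    have "orbit (?c \<circ> p) ` (set cs \<union> I) = insert (set cs) (orbit p ` I)"
      using False orb1 orb2 by (auto simp: image_Un image_iff)
    moreover have "set cs \<notin> orbit p ` I"
    proof
      assume "set cs \<in> orbit p ` I"
      then have "set cs \<subseteq> I" using permutes_orbit_subset[OF p] by auto
      then have "set cs = {}" using disj Int_absorb2[of "set cs" I] by simp
      then show False using False by simp
    qed
    ultimately have 1: "card (orbit (?c \<circ> p) ` (set cs \<union> I)) = Suc (card (orbit p ` I))"
      using finI by simp
    have 2: "card (set cs \<union> I) = length cs + card I"
      using disj finI dist by (simp add: card_Un_disjoint distinct_card)
    have 3: "sign ?c * (-1) = (-1) ^ length cs"
      using sign_cycle_of_list[OF dist False] False by (cases cs) auto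
    have "sign (?c \<circ> p) * (-1) ^ card (orbit (?c \<circ> p) ` (set cs \<union> I)) =
        (sign ?c * (-1)) * (sign p * (-1) ^ card (orbit p ` I))"
      unfolding 1 sgn by simp
    also have "\<dots> = (-1) ^ card (set cs \<union> I)" unfolding 3 IH 2 by (simp add: power_add)
    finally show ?thesis using perm finI by (intro conjI finite_UnI finite_set)
  qed
qed

lemma sign_orbits:
  assumes "\<sigma> \<in> perms N"
  shows "sign \<sigma> * (-1) ^ card (orbit \<sigma> ` {..<N}) = (-1) ^ N"
proof -
  have "cycle_decomp {..<N} \<sigma>" using assms by (intro cycle_decomposition) auto
  from cycle_decomp_sign_orbits[OF this] show ?thesis by simp
qed

text \<open>A box is a row together with a column within the length of that row. One condition
  concerns only the row function and the other only the column function, but the range of the second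
  depends on the first; hence a sum of counts.\<close>

lemma card_fillings:
  fixes \<omega>
  defines "n \<equiv> sum_list \<omega>"
  assumes \<sigma>: "\<sigma> \<in> perms k" and \<sigma>': "\<sigma>' \<in> perms k"
  shows "card {f \<in> {..<k} \<rightarrow>\<^sub>E {..<n}. (\<forall>x<k. box_row \<omega> (f (\<sigma> x)) = box_row \<omega> (f x)) \<and>
      (\<forall>x<k. box_col \<omega> (f (\<sigma>' x)) = box_col \<omega> (f x))} =
    (\<Sum>r\<in>invariant_fns k \<sigma> (\<lambda>_. {..<length \<omega>}). card (invariant_fns k \<sigma>' (\<lambda>x. {..<\<omega> ! r x})))"
    (is "card ?F = _")
proof -
  let ?R = "invariant_fns k \<sigma> (\<lambda>_. {..<length \<omega>})"
  let ?C = "\<lambda>r. invariant_fns k \<sigma>' (\<lambda>x. {..<\<omega> ! r x})"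
  have lt: "\<sigma> x < k" "\<sigma>' x < k" if "x < k" for x using that \<sigma> \<sigma>' by (auto simp: permutes_less)
  have "bij_betw (\<lambda>f. (\<lambda>x\<in>{..<k}. box_row \<omega> (f x), \<lambda>x\<in>{..<k}. box_col \<omega> (f x))) ?F (Sigma ?R ?C)"
  proof (rule bij_betw_byWitness[where
        f' = "\<lambda>(r, c). \<lambda>x\<in>{..<k}. sum_list (take (r x) \<omega>) + c x"])
    show "\<forall>f\<in>?F. (case (\<lambda>x\<in>{..<k}. box_row \<omega> (f x), \<lambda>x\<in>{..<k}. box_col \<omega> (f x)) of
        (r, c) \<Rightarrow> \<lambda>x\<in>{..<k}. sum_list (take (r x) \<omega>) + c x) = f"
    proof
      fix f assume f: "f \<in> ?F"
      then have "sum_list (take (box_row \<omega> (f x)) \<omega>) + box_col \<omega> (f x) = f x" if "x < k" for x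
        using that by (intro box_in_diagram) (auto simp: n_def)
      moreover have "f x = undefined" if "\<not> x < k" for x
        using f that by (auto simp: PiE_def extensional_def)
      ultimately show "(case (\<lambda>x\<in>{..<k}. box_row \<omega> (f x), \<lambda>x\<in>{..<k}. box_col \<omega> (f x)) of
        (r, c) \<Rightarrow> \<lambda>x\<in>{..<k}. sum_list (take (r x) \<omega>) + c x) = f"
        by (auto simp: fun_eq_iff restrict_def)
    qed
    show "(\<lambda>f. (\<lambda>x\<in>{..<k}. box_row \<omega> (f x), \<lambda>x\<in>{..<k}. box_col \<omega> (f x))) ` ?F \<subseteq> Sigma ?R ?C"
      using lt by (auto simp: invariant_fns_def n_def box_in_diagram PiE_iff)
    have pos: "box_row \<omega> (sum_list (take (r x) \<omega>) + c x) = r x \<and>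
        box_col \<omega> (sum_list (take (r x) \<omega>) + c x) = c x \<and> sum_list (take (r x) \<omega>) + c x < n"
      if "r \<in> ?R" "c \<in> ?C r" "x < k" for r c x
    proof -
      have "r x < length \<omega>" "c x < \<omega> ! r x" using that by (auto simp: invariant_fns_def PiE_iff)
      then show ?thesis by (simp add: box_position n_def)
    qed
    have ext: "r x = undefined" if "r \<in> invariant_fns k \<tau> A" "\<not> x < k" for r x \<tau> A
      using that by (auto simp: invariant_fns_def PiE_def extensional_def)
    show "\<forall>rc\<in>Sigma ?R ?C. (\<lambda>f. (\<lambda>x\<in>{..<k}. box_row \<omega> (f x), \<lambda>x\<in>{..<k}. box_col \<omega> (f x)))
        (case rc of (r, c) \<Rightarrow> \<lambda>x\<in>{..<k}. sum_list (take (r x) \<omega>) + c x) = rc"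
    proof
      fix rc assume "rc \<in> Sigma ?R ?C"
      then obtain r c where rc_eq: "rc = (r, c)" and rc: "r \<in> ?R" "c \<in> ?C r" by auto
      have "(\<lambda>x\<in>{..<k}. box_row \<omega> ((\<lambda>x\<in>{..<k}. sum_list (take (r x) \<omega>) + c x) x)) = r"
        "(\<lambda>x\<in>{..<k}. box_col \<omega> ((\<lambda>x\<in>{..<k}. sum_list (take (r x) \<omega>) + c x) x)) = c"
        using pos[OF rc] ext[OF rc(1)] ext[OF rc(2)] by (auto simp: fun_eq_iff restrict_def)
      then show "(\<lambda>f. (\<lambda>x\<in>{..<k}. box_row \<omega> (f x), \<lambda>x\<in>{..<k}. box_col \<omega> (f x)))
        (case rc of (r, c) \<Rightarrow> \<lambda>x\<in>{..<k}. sum_list (take (r x) \<omega>) + c x) = rc" by (simp add: rc_eq)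
    qed
    show "(\<lambda>(r, c). \<lambda>x\<in>{..<k}. sum_list (take (r x) \<omega>) + c x) ` Sigma ?R ?C \<subseteq> ?F"
    proof (rule image_subsetI)
      fix rc assume "rc \<in> Sigma ?R ?C"
      then obtain r c where rc_eq: "rc = (r, c)" and rc: "r \<in> ?R" "c \<in> ?C r" by auto
      let ?f = "\<lambda>x\<in>{..<k}. sum_list (take (r x) \<omega>) + c x"
      have "?f \<in> {..<k} \<rightarrow>\<^sub>E {..<n}" using pos[OF rc] by auto
      have "r (\<sigma> x) = r x" "c (\<sigma>' x) = c x" if "x < k" for x
        using rc that by (auto simp: invariant_fns_def)
      then have "box_row \<omega> (?f (\<sigma> x)) = box_row \<omega> (?f x)"
        "box_col \<omega> (?f (\<sigma>' x)) = box_col \<omega> (?f x)" if "x < k" for x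
        using that pos[OF rc that] pos[OF rc lt(1)[OF that]] pos[OF rc lt(2)[OF that]] lt[OF that]
        by simp_all
      then show "(case rc of (r, c) \<Rightarrow> \<lambda>x\<in>{..<k}. sum_list (take (r x) \<omega>) + c x) \<in> ?F"
        using \<open>?f \<in> {..<k} \<rightarrow>\<^sub>E {..<n}\<close> by (simp add: rc_eq)
    qed
  qed
  then have "card ?F = card (Sigma ?R ?C)" by (rule bij_betw_same_card)
  also have "\<dots> = (\<Sum>r\<in>?R. card (?C r))"
    by (intro card_SigmaI finite_invariant_fns ballI) auto
  finally show ?thesis .
qed

section \<open>Rows grouped into blocks of equal length\<close>

definition block_list :: "nat \<Rightarrow> (nat \<Rightarrow> nat) \<Rightarrow> nat list" where
  "block_list m p = concat (map (\<lambda>i. replicate (p i) i) [1..<Suc m])"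

text \<open>Block labels instead of row lengths make the choice of rows depend on \<open>p\<close>
  alone.\<close>

lemma pq_shape_eq_map: "pq_shape m p q = map q (block_list m p)"
  by (simp add: pq_shape_def block_list_def map_concat o_def)

lemma set_block_list: "set (block_list m p) \<subseteq> {1..m}"
  by (auto simp: block_list_def)

lemma card_block:
  assumes "i \<in> {1..m}"
  shows "card {j. j < length (block_list m p) \<and> block_list m p ! j = i} = p i"
proof -
  have *: "length (filter (\<lambda>a. a = i) (concat (map (\<lambda>i. replicate (p i) i) ls))) =
      (if i \<in> set ls then p i else 0)" if "distinct ls" for ls
    using that by (induction ls) (auto simp: filter_replicate)
  have "card {j. j < length (block_list m p) \<and> block_list m p ! j = i} =
      length (filter (\<lambda>a. a = i) (block_list m p))"
    by (simp add: length_filter_conv_card)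
  also have "\<dots> = p i" unfolding block_list_def by (subst *) (use assms in auto)
  finally show ?thesis .
qed

lemma sum_list_pq_shape: "sum_list (pq_shape m p q) = (\<Sum>i=1..m. p i * q i)"
proof -
  have "sum_list (concat (map (\<lambda>i. replicate (p i) (q i)) ls)) = (\<Sum>i\<leftarrow>ls. p i * q i)" for ls
    by (induction ls) (auto simp: sum_list_replicate)
  then have "sum_list (pq_shape m p q) = (\<Sum>i\<leftarrow>[1..<Suc m]. p i * q i)"
    by (simp add: pq_shape_def del: upt_Suc)
  also have "\<dots> = (\<Sum>i=1..m. p i * q i)"
    by (subst sum_set_upt_conv_sum_list_nat[symmetric]) (simp add: atLeastLessThanSuc_atLeastAtMost del: upt_Suc)
  finally show ?thesis .
qed

lemma orbit_image_Max:
  assumes \<sigma>: "\<sigma> \<in> perms k" and \<phi>: "\<phi> \<in> {..<k} \<rightarrow>\<^sub>E {1..m::nat}" and X: "X \<in> orbit \<sigma> ` {..<k}"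
  shows "finite (\<phi> ` X)" "\<phi> ` X \<noteq> {}" "Max (\<phi> ` X) \<in> {1..m}"
proof -
  have "X \<subseteq> {..<k}" using X orbit_less[OF \<sigma>] by auto
  then show fin: "finite (\<phi> ` X)" by (simp add: finite_subset)
  show ne: "\<phi> ` X \<noteq> {}" using X orbit_nonempty[of \<sigma>] by auto
  have "\<phi> ` X \<subseteq> {1..m}" using \<open>X \<subseteq> {..<k}\<close> \<phi> by (force simp: PiE_iff)
  then show "Max (\<phi> ` X) \<in> {1..m}" using Max_in[OF fin ne] by blast
qed

text \<open>A colouring is constant on a cycle of \<open>\<sigma>\<close>, so \<open>Max\<close>
  merely names its colour there; any row of that block may be chosen for the cycle.\<close>

lemma card_row_choices:
  assumes \<sigma>: "\<sigma> \<in> perms k" and \<phi>: "\<phi> \<in> invariant_fns k \<sigma> (\<lambda>_. {1..m})"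
  shows "card (invariant_fns k \<sigma> (\<lambda>x. {j. j < length (block_list m p) \<and> block_list m p ! j = \<phi> x})) =
    (\<Prod>X\<in>orbit \<sigma> ` {..<k}. p (Max (\<phi> ` X)))"
  unfolding card_invariant_fns[OF \<sigma>]
proof (rule prod.cong[OF refl])
  fix X assume X: "X \<in> orbit \<sigma> ` {..<k}"
  have \<phi>': "\<phi> \<in> {..<k} \<rightarrow>\<^sub>E {1..m}" and inv: "\<forall>x<k. \<phi> (\<sigma> x) = \<phi> x"
    using \<phi> by (auto simp: invariant_fns_def)
  note mx = orbit_image_Max[OF \<sigma> \<phi>' X]
  obtain x0 where x0: "x0 < k" "X = orbit \<sigma> x0" using X by auto
  define y where "y = \<phi> x0"
  have y: "\<phi> x = y" if "x \<in> X" for x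
    unfolding y_def using invariant_on_orbit[OF \<sigma> inv x0(1)] that x0(2) by metis
  have "x0 \<in> X" using x0 self_mem_orbit[OF \<sigma>] by simp
  then have "\<phi> ` X = {y}" using y by (intro equalityI image_subsetI) auto
  then have const: "\<phi> x = Max (\<phi> ` X)" if "x \<in> X" for x using y[OF that] by simp
  have "(\<Inter>x\<in>X. {j. j < length (block_list m p) \<and> block_list m p ! j = \<phi> x}) =
      {j. j < length (block_list m p) \<and> block_list m p ! j = Max (\<phi> ` X)}"
    using const \<open>x0 \<in> X\<close> by auto
  then show "card (\<Inter>x\<in>X. {j. j < length (block_list m p) \<and> block_list m p ! j = \<phi> x}) =
      p (Max (\<phi> ` X))"
    using card_block[OF mx(3)] by simp
qed

text \<open>A column allowed at all points of a cycle must fit into the shortest row met. As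
  \<open>q\<close> decreases, that row lies in the block of largest index, hence
  \<open>Max\<close>.\<close>

lemma card_col_choices:
  assumes \<sigma>: "\<sigma> \<in> perms k" and \<phi>: "\<phi> \<in> {..<k} \<rightarrow>\<^sub>E {1..m::nat}"
    and q: "\<forall>i\<in>{1..m}. \<forall>j\<in>{1..m}. i < j \<longrightarrow> q i > q j"
  shows "card (invariant_fns k \<sigma> (\<lambda>x. {..<q (\<phi> x)})) = (\<Prod>X\<in>orbit \<sigma> ` {..<k}. q (Max (\<phi> ` X)))"
  unfolding card_invariant_fns[OF \<sigma>]
proof (rule prod.cong[OF refl])
  fix X assume X: "X \<in> orbit \<sigma> ` {..<k}"
  note mx = orbit_image_Max[OF \<sigma> \<phi> X]
  have "q (Max (\<phi> ` X)) \<le> q (\<phi> x)" if x: "x \<in> X" for x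
  proof -
    have "x < k" using X x orbit_less[OF \<sigma>] by auto
    then have "\<phi> x \<in> {1..m}" using \<phi> by (auto simp: PiE_iff)
    moreover have "\<phi> x \<le> Max (\<phi> ` X)" using mx(1) x by simp
    ultimately show ?thesis using q mx(3) by (metis le_neq_implies_less order_refl less_imp_le)
  qed
  moreover obtain x1 where "x1 \<in> X" "\<phi> x1 = Max (\<phi> ` X)" using Max_in[OF mx(1,2)] by auto
  ultimately have "(\<Inter>x\<in>X. {..<q (\<phi> x)}) = {..<q (Max (\<phi> ` X))}"
    by (force intro: order_less_le_trans)
  then show "card (\<Inter>x\<in>X. {..<q (\<phi> x)}) = q (Max (\<phi> ` X))" by simp
qed

text \<open>The number of column choices sees the rows only through their blocks, so row functions
  can be grouped by their colouring.\<close>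

lemma sum_rows_by_block:
  fixes G :: "(nat \<Rightarrow> nat) \<Rightarrow> nat"
  assumes \<sigma>: "\<sigma> \<in> perms k" and b: "\<And>j. j < l \<Longrightarrow> b j \<in> {1..m}"
  shows "(\<Sum>r\<in>invariant_fns k \<sigma> (\<lambda>_. {..<l}). G (\<lambda>x\<in>{..<k}. b (r x))) =
    (\<Sum>\<phi>\<in>invariant_fns k \<sigma> (\<lambda>_. {1..m}).
       card (invariant_fns k \<sigma> (\<lambda>x. {j. j < l \<and> b j = \<phi> x})) * G \<phi>)"
proof -
  let ?R = "invariant_fns k \<sigma> (\<lambda>_. {..<l})" and ?\<Phi> = "invariant_fns k \<sigma> (\<lambda>_. {1..m})"
  have lt: "\<sigma> x < k" if "x < k" for x using that \<sigma> by (auto simp: permutes_less)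
  have "(\<lambda>x\<in>{..<k}. b (r x)) \<in> ?\<Phi>" if "r \<in> ?R" for r
    using that b lt by (auto simp: invariant_fns_def PiE_iff)
  then have "(\<Sum>r\<in>?R. G (\<lambda>x\<in>{..<k}. b (r x))) =
      (\<Sum>\<phi>\<in>?\<Phi>. \<Sum>r\<in>{r\<in>?R. (\<lambda>x\<in>{..<k}. b (r x)) = \<phi>}. G (\<lambda>x\<in>{..<k}. b (r x)))"
    by (intro sum.group[symmetric] finite_invariant_fns) auto
  also have "\<dots> = (\<Sum>\<phi>\<in>?\<Phi>. card (invariant_fns k \<sigma> (\<lambda>x. {j. j < l \<and> b j = \<phi> x})) * G \<phi>)"
  proof (rule sum.cong[OF refl])
    fix \<phi> assume \<phi>: "\<phi> \<in> ?\<Phi>"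
    let ?S = "{r\<in>?R. (\<lambda>x\<in>{..<k}. b (r x)) = \<phi>}"
    have "(\<Sum>r\<in>?S. G (\<lambda>x\<in>{..<k}. b (r x))) = (\<Sum>r\<in>?S. G \<phi>)" by (intro sum.cong) auto
    moreover have "?S = invariant_fns k \<sigma> (\<lambda>x. {j. j < l \<and> b j = \<phi> x})"
      using \<phi> by (auto simp: invariant_fns_def PiE_iff fun_eq_iff restrict_def extensional_def)
    ultimately show "(\<Sum>r\<in>?S. G (\<lambda>x\<in>{..<k}. b (r x))) =
        card (invariant_fns k \<sigma> (\<lambda>x. {j. j < l \<and> b j = \<phi> x})) * G \<phi>"
      by simp
  qed
  finally show ?thesis .
qed

text \<open>Stanley's character formula in the form of Feray and Sniady: \<open>\<phi>\<close> colours the cycles of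
  \<open>\<sigma>\<close> by blocks of equal rows, and a cycle of the cofactor sees the shortest row that it meets.\<close>

theorem normalized_char_pq_shape:
  fixes k m :: nat and p q :: "nat \<Rightarrow> nat"
  defines "\<rho> \<equiv> inv (cycle_of_list [0..<k])"
  assumes q: "\<forall>i\<in>{1..m}. \<forall>j\<in>{1..m}. i < j \<longrightarrow> q i > q j"
    and k: "(\<Sum>i=1..m. p i * q i) \<ge> k"
  shows "normalized_char (pq_shape m p q) k =
    (\<Sum>\<sigma>\<in>perms k. \<Sum>\<phi>\<in>invariant_fns k \<sigma> (\<lambda>_. {1..m}). of_int (sign (inv \<sigma> \<circ> \<rho>)) *
       of_nat ((\<Prod>X\<in>orbit \<sigma> ` {..<k}. p (Max (\<phi> ` X))) *
        (\<Prod>X\<in>orbit (inv \<sigma> \<circ> \<rho>) ` {..<k}. q (Max (\<phi> ` X)))))"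
proof -
  let ?\<omega> = "pq_shape m p q" and ?b = "block_list m p"
  let ?n = "sum_list ?\<omega>"
  let ?F = "{..<k} \<rightarrow>\<^sub>E {..<?n}"
  let ?P = "\<lambda>\<sigma> f. (\<forall>x<k. box_row ?\<omega> (f (\<sigma> x)) = box_row ?\<omega> (f x)) \<and>
      (\<forall>x<k. box_col ?\<omega> (f ((inv \<sigma> \<circ> \<rho>) x)) = box_col ?\<omega> (f x))"
  have "cycle_of_list [0..<k] permutes set [0..<k]" by (rule cycle_permutes)
  then have \<rho>: "\<rho> \<in> perms k" by (simp add: \<rho>_def permutes_inv atLeast0LessThan)
  have len: "length ?\<omega> = length ?b" by (simp add: pq_shape_eq_map)
  have b: "?b ! j \<in> {1..m}" if "j < length ?b" for j
    using that set_block_list[of m p] nth_mem by blast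
  have "normalized_char ?\<omega> k =
      (\<Sum>f\<in>?F. factorization_sum k \<rho> (box_row ?\<omega> \<circ> f) (box_col ?\<omega> \<circ> f))"
    unfolding \<rho>_def using k
    by (intro normalized_char_eq_factorization_sum) (simp only: sum_list_pq_shape)
  also have "\<dots> = (\<Sum>f\<in>?F. \<Sum>\<sigma>\<in>perms k.
      if ?P \<sigma> f then of_int (sign (inv \<sigma> \<circ> \<rho>)) else 0)"
    by (simp only: factorization_sum_def o_apply)
  also have "\<dots> = (\<Sum>\<sigma>\<in>perms k. \<Sum>f\<in>?F. if ?P \<sigma> f then of_int (sign (inv \<sigma> \<circ> \<rho>)) else 0)"
    by (rule sum.swap)
  also have "\<dots> = (\<Sum>\<sigma>\<in>perms k. of_int (sign (inv \<sigma> \<circ> \<rho>)) * of_nat (card {f\<in>?F. ?P \<sigma> f}))"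
  proof (rule sum.cong[OF refl])
    fix \<sigma>
    have "(\<Sum>f\<in>?F. if ?P \<sigma> f then of_int (sign (inv \<sigma> \<circ> \<rho>)) else 0) =
        (\<Sum>f\<in>{f\<in>?F. ?P \<sigma> f}. of_int (sign (inv \<sigma> \<circ> \<rho>)) :: complex)"
      by (rule sum.inter_filter[symmetric]) (simp add: finite_PiE)
    then show "(\<Sum>f\<in>?F. if ?P \<sigma> f then of_int (sign (inv \<sigma> \<circ> \<rho>)) else 0) =
        (of_int (sign (inv \<sigma> \<circ> \<rho>)) * of_nat (card {f\<in>?F. ?P \<sigma> f}) :: complex)"
      by (simp add: mult.commute)
  qed
  also have "\<dots> = (\<Sum>\<sigma>\<in>perms k. \<Sum>\<phi>\<in>invariant_fns k \<sigma> (\<lambda>_. {1..m}). of_int (sign (inv \<sigma> \<circ> \<rho>)) *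
       of_nat ((\<Prod>X\<in>orbit \<sigma> ` {..<k}. p (Max (\<phi> ` X))) *
        (\<Prod>X\<in>orbit (inv \<sigma> \<circ> \<rho>) ` {..<k}. q (Max (\<phi> ` X)))))"
  proof (rule sum.cong[OF refl])
    fix \<sigma> assume \<sigma>: "\<sigma> \<in> perms k"
    define \<sigma>' where "\<sigma>' = inv \<sigma> \<circ> \<rho>"
    have \<sigma>': "\<sigma>' \<in> perms k" using \<sigma> \<rho> by (simp add: \<sigma>'_def permutes_compose permutes_inv)
    define G where "G \<phi> = card (invariant_fns k \<sigma>' (\<lambda>x. {..<q (\<phi> x)}))" for \<phi>
    have "card {f\<in>?F. ?P \<sigma> f} =
        (\<Sum>r\<in>invariant_fns k \<sigma> (\<lambda>_. {..<length ?b}). card (invariant_fns k \<sigma>' (\<lambda>x. {..<?\<omega> ! r x})))"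
      using card_fillings[OF \<sigma> \<sigma>', of ?\<omega>] by (simp only: \<sigma>'_def len)
    also have "\<dots> = (\<Sum>r\<in>invariant_fns k \<sigma> (\<lambda>_. {..<length ?b}). G (\<lambda>x\<in>{..<k}. ?b ! r x))"
    proof (rule sum.cong[OF refl])
      fix r assume "r \<in> invariant_fns k \<sigma> (\<lambda>_. {..<length ?b})"
      then have "?\<omega> ! r x = q ((\<lambda>x\<in>{..<k}. ?b ! r x) x)" if "x < k" for x
        using that by (auto simp: invariant_fns_def pq_shape_eq_map PiE_iff)
      \<comment> \<open>The two ranges agree only below \<open>k\<close>, where
        \<open>restrict\<close> does not return \<open>undefined\<close>; \<open>PiE\<close> sees no
        other points.\<close>
      then have "PiE {..<k} (\<lambda>x. {..<?\<omega> ! r x}) = PiE {..<k} (\<lambda>x. {..<q ((\<lambda>x\<in>{..<k}. ?b ! r x) x)})"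
        by (intro PiE_cong) simp
      then show "card (invariant_fns k \<sigma>' (\<lambda>x. {..<?\<omega> ! r x})) = G (\<lambda>x\<in>{..<k}. ?b ! r x)"
        by (simp only: G_def invariant_fns_def)
    qed
    also have "\<dots> = (\<Sum>\<phi>\<in>invariant_fns k \<sigma> (\<lambda>_. {1..m}).
       card (invariant_fns k \<sigma> (\<lambda>x. {j. j < length ?b \<and> ?b ! j = \<phi> x})) * G \<phi>)"
      by (rule sum_rows_by_block[OF \<sigma> b])
    also have "\<dots> = (\<Sum>\<phi>\<in>invariant_fns k \<sigma> (\<lambda>_. {1..m}).
        (\<Prod>X\<in>orbit \<sigma> ` {..<k}. p (Max (\<phi> ` X))) * (\<Prod>X\<in>orbit \<sigma>' ` {..<k}. q (Max (\<phi> ` X))))"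
    proof (rule sum.cong[OF refl])
      fix \<phi> assume \<phi>: "\<phi> \<in> invariant_fns k \<sigma> (\<lambda>_. {1..m})"
      then have "\<phi> \<in> {..<k} \<rightarrow>\<^sub>E {1..m}" by (simp add: invariant_fns_def)
      then show "card (invariant_fns k \<sigma> (\<lambda>x. {j. j < length ?b \<and> ?b ! j = \<phi> x})) * G \<phi> =
        (\<Prod>X\<in>orbit \<sigma> ` {..<k}. p (Max (\<phi> ` X))) * (\<Prod>X\<in>orbit \<sigma>' ` {..<k}. q (Max (\<phi> ` X)))"
        using card_row_choices[OF \<sigma> \<phi>, of p] card_col_choices[OF \<sigma>' _ q, of \<phi>]
        by (simp only: G_def)
    qed
    finally show "of_int (sign (inv \<sigma> \<circ> \<rho>)) * of_nat (card {f\<in>?F. ?P \<sigma> f}) =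
        (\<Sum>\<phi>\<in>invariant_fns k \<sigma> (\<lambda>_. {1..m}). of_int (sign (inv \<sigma> \<circ> \<rho>)) *
       of_nat ((\<Prod>X\<in>orbit \<sigma> ` {..<k}. p (Max (\<phi> ` X))) *
        (\<Prod>X\<in>orbit (inv \<sigma> \<circ> \<rho>) ` {..<k}. q (Max (\<phi> ` X)))) :: complex)"
      by (simp only: \<sigma>'_def of_nat_sum sum_distrib_left)
  qed
  finally show ?thesis .
qed

section \<open>The character polynomial\<close>

definition monom_val :: "(pq_var \<Rightarrow> 'b::comm_ring_1) \<Rightarrow> pq_monom \<Rightarrow> 'b" where
  "monom_val s \<alpha> = (\<Prod>v\<in>Poly_Mapping.keys \<alpha>. s v ^ Poly_Mapping.lookup \<alpha> v)"

lemma monom_val_superset: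
  assumes "finite V" "Poly_Mapping.keys \<alpha> \<subseteq> V"
  shows "monom_val s \<alpha> = (\<Prod>v\<in>V. s v ^ Poly_Mapping.lookup \<alpha> v)"
  unfolding monom_val_def using assms
  by (intro prod.mono_neutral_left) (auto simp: in_keys_iff)

lemma monom_val_zero [simp]: "monom_val s 0 = 1"
  by (simp add: monom_val_def)

lemma monom_val_single [simp]: "monom_val s (Poly_Mapping.single v (Suc 0)) = s v"
  by (simp add: monom_val_def)

lemma monom_val_add: "monom_val s (\<alpha> + \<beta>) = monom_val s \<alpha> * monom_val s \<beta>"
proof -
  let ?V = "Poly_Mapping.keys \<alpha> \<union> Poly_Mapping.keys \<beta>"
  have "monom_val s (\<alpha> + \<beta>) = (\<Prod>v\<in>?V. s v ^ Poly_Mapping.lookup (\<alpha> + \<beta>) v)"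
    by (intro monom_val_superset Poly_Mapping.keys_add) simp
  also have "\<dots> = (\<Prod>v\<in>?V. s v ^ Poly_Mapping.lookup \<alpha> v) * (\<Prod>v\<in>?V. s v ^ Poly_Mapping.lookup \<beta> v)"
    by (simp add: lookup_add power_add prod.distrib)
  also have "\<dots> = monom_val s \<alpha> * monom_val s \<beta>"
    by (simp add: monom_val_superset[of ?V])
  finally show ?thesis .
qed

lemma monom_val_sum: "monom_val s (\<Sum>i\<in>I. f i) = (\<Prod>i\<in>I. monom_val s (f i))"
  by (induction I rule: infinite_finite_induct) (auto simp: monom_val_add)

lemma pq_hom_superset:
  assumes "h 0 = 0" "finite S" "Poly_Mapping.keys F \<subseteq> S"
  shows "pq_hom h s F = (\<Sum>\<alpha>\<in>S. h (Poly_Mapping.lookup F \<alpha>) * monom_val s \<alpha>)"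
  unfolding pq_hom_def monom_val_def[symmetric] using assms
  by (intro sum.mono_neutral_left) (auto simp: in_keys_iff)

lemma pq_hom_single: "h 0 = 0 \<Longrightarrow> pq_hom h s (Poly_Mapping.single \<alpha> c) = h c * monom_val s \<alpha>"
  by (subst pq_hom_superset[of _ "{\<alpha>}"]) auto

lemma pq_hom_add:
  assumes "h 0 = 0" "\<And>a b. h (a + b) = h a + h b"
  shows "pq_hom h s (F + G) = pq_hom h s F + pq_hom h s G"
proof -
  let ?S = "Poly_Mapping.keys F \<union> Poly_Mapping.keys G"
  have "pq_hom h s (F + G) = (\<Sum>\<alpha>\<in>?S. h (Poly_Mapping.lookup (F + G) \<alpha>) * monom_val s \<alpha>)"
    by (intro pq_hom_superset assms Poly_Mapping.keys_add) simp
  also have "\<dots> = (\<Sum>\<alpha>\<in>?S. h (Poly_Mapping.lookup F \<alpha>) * monom_val s \<alpha>) +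
      (\<Sum>\<alpha>\<in>?S. h (Poly_Mapping.lookup G \<alpha>) * monom_val s \<alpha>)"
    by (simp add: lookup_add assms algebra_simps sum.distrib)
  also have "\<dots> = pq_hom h s F + pq_hom h s G"
    using assms by (simp add: pq_hom_superset[of h ?S])
  finally show ?thesis .
qed

lemma pq_hom_sum:
  assumes "h 0 = 0" "\<And>a b. h (a + b) = h a + h b"
  shows "pq_hom h s (\<Sum>i\<in>I. F i) = (\<Sum>i\<in>I. pq_hom h s (F i))"
  by (induction I rule: infinite_finite_induct)
    (auto simp: pq_hom_add[of h, OF assms] pq_hom_def[of h s 0])

lemma pq_eval_diff: "pq_eval p q (F - G) = pq_eval p q F - pq_eval p q G"
proof -
  have "pq_eval p q (F - G) + pq_eval p q G = pq_eval p q (F - G + G)"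
    unfolding pq_eval_def by (intro pq_hom_add[symmetric]) auto
  then show ?thesis by simp
qed

section \<open>The explicit polynomial and its values\<close>

definition cycle_monom :: "nat \<Rightarrow> (nat \<Rightarrow> nat) \<Rightarrow> (nat \<Rightarrow> nat) \<Rightarrow> (nat \<Rightarrow> nat) \<Rightarrow> pq_monom" where
  "cycle_monom k \<sigma> \<sigma>' \<phi> =
     (\<Sum>X\<in>orbit \<sigma> ` {..<k}. Poly_Mapping.single (P (Max (\<phi> ` X))) 1) +
     (\<Sum>X\<in>orbit \<sigma>' ` {..<k}. Poly_Mapping.single (Q (Max (\<phi> ` X))) 1)"

text \<open>Different pairs may give the same monomial, but then with the same sign: the degree of
  the monomial in the \<open>Q\<close> variables is the number of cycles of the cofactor.\<close>

definition factorization_poly :: "nat \<Rightarrow> nat \<Rightarrow> pq_poly" where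
  "factorization_poly m k =
     (\<Sum>\<sigma>\<in>perms k. \<Sum>\<phi>\<in>invariant_fns k \<sigma> (\<lambda>_. {1..m}).
        Poly_Mapping.single (cycle_monom k \<sigma> (inv \<sigma> \<circ> inv (cycle_of_list [0..<k])) \<phi>)
          (of_int (sign (inv \<sigma> \<circ> inv (cycle_of_list [0..<k])))))"

lemma monom_val_cycle_monom:
  "monom_val s (cycle_monom k \<sigma> \<sigma>' \<phi>) =
     (\<Prod>X\<in>orbit \<sigma> ` {..<k}. s (P (Max (\<phi> ` X)))) * (\<Prod>X\<in>orbit \<sigma>' ` {..<k}. s (Q (Max (\<phi> ` X))))"
  by (simp add: cycle_monom_def monom_val_add monom_val_sum)

lemma full_cycle_perms: "cycle_of_list [0..<k] \<in> perms k"
  using cycle_permutes[of "[0..<k]"] by (simp add: atLeast0LessThan)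

lemma cofactor_perms: "\<sigma> \<in> perms k \<Longrightarrow> inv \<sigma> \<circ> inv (cycle_of_list [0..<k]) \<in> perms k"
  using full_cycle_perms[of k] by (simp add: permutes_compose permutes_inv)

lemma keys_cycle_monom:
  assumes "\<sigma> \<in> perms k" "\<sigma>' \<in> perms k" "\<phi> \<in> {..<k} \<rightarrow>\<^sub>E {1..m}"
  shows "Poly_Mapping.keys (cycle_monom k \<sigma> \<sigma>' \<phi>) \<subseteq> P ` {1..m} \<union> Q ` {1..m}"
proof -
  have "Poly_Mapping.keys (cycle_monom k \<sigma> \<sigma>' \<phi>) \<subseteq>
      (\<Union>X\<in>orbit \<sigma> ` {..<k}. {P (Max (\<phi> ` X))}) \<union> (\<Union>X\<in>orbit \<sigma>' ` {..<k}. {Q (Max (\<phi> ` X))})"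
    unfolding cycle_monom_def
    by (intro order_trans[OF Poly_Mapping.keys_add] Un_mono order_trans[OF keys_sum] UN_mono) auto
  also have "\<dots> \<subseteq> P ` {1..m} \<union> Q ` {1..m}"
    using orbit_image_Max(3)[OF assms(1,3)] orbit_image_Max(3)[OF assms(2,3)]
    by (intro Un_mono UN_least) blast+
  finally show ?thesis .
qed

lemma is_stanley_poly_factorization_poly: "is_stanley_poly m k (factorization_poly m k)"
  unfolding is_stanley_poly_def
proof (intro conjI allI impI)
  let ?c = "\<lambda>\<sigma>. inv \<sigma> \<circ> inv (cycle_of_list [0..<k])"
  show "pq_vars (factorization_poly m k) \<subseteq> P ` {1..m} \<union> Q ` {1..m}"
    unfolding pq_vars_def
  proof (rule UN_least)
    fix \<alpha> assume "\<alpha> \<in> Poly_Mapping.keys (factorization_poly m k)"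
    then obtain \<sigma> where \<sigma>: "\<sigma> \<in> perms k" and *: "\<alpha> \<in> Poly_Mapping.keys
        (\<Sum>\<phi>\<in>invariant_fns k \<sigma> (\<lambda>_. {1..m}).
          Poly_Mapping.single (cycle_monom k \<sigma> (?c \<sigma>) \<phi>) (real_of_int (sign (?c \<sigma>))))"
      unfolding factorization_poly_def by (rule UN_E[OF subsetD[OF keys_sum]])
    from * obtain \<phi> where \<phi>: "\<phi> \<in> invariant_fns k \<sigma> (\<lambda>_. {1..m})"
      and "\<alpha> \<in> Poly_Mapping.keys
        (Poly_Mapping.single (cycle_monom k \<sigma> (?c \<sigma>) \<phi>) (real_of_int (sign (?c \<sigma>))))"
      by (rule UN_E[OF subsetD[OF keys_sum]])
    then have "\<alpha> = cycle_monom k \<sigma> (?c \<sigma>) \<phi>" by (auto split: if_splits)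
    then show "Poly_Mapping.keys \<alpha> \<subseteq> P ` {1..m} \<union> Q ` {1..m}"
      using keys_cycle_monom[OF \<sigma> cofactor_perms[OF \<sigma>], of \<phi> m] \<phi> by (simp add: invariant_fns_def)
  qed
  fix p q :: "nat \<Rightarrow> nat"
  assume pq: "(\<forall>i\<in>{1..m}. p i > 0) \<and> (\<forall>i\<in>{1..m}. q i > 0) \<and>
        (\<forall>i\<in>{1..m}. \<forall>j\<in>{1..m}. i < j \<longrightarrow> q i > q j) \<and> (\<Sum>i=1..m. p i * q i) \<ge> k"
  have "pq_eval p q (factorization_poly m k) =
      (\<Sum>\<sigma>\<in>perms k. \<Sum>\<phi>\<in>invariant_fns k \<sigma> (\<lambda>_. {1..m}). of_int (sign (?c \<sigma>)) *
         of_nat ((\<Prod>X\<in>orbit \<sigma> ` {..<k}. p (Max (\<phi> ` X))) *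
           (\<Prod>X\<in>orbit (?c \<sigma>) ` {..<k}. q (Max (\<phi> ` X)))))"
    by (simp add: pq_eval_def factorization_poly_def pq_hom_sum pq_hom_single monom_val_cycle_monom
        del: o_apply)
  then show "complex_of_real (pq_eval p q (factorization_poly m k)) = normalized_char (pq_shape m p q) k"
    using pq by (subst normalized_char_pq_shape) (simp_all del: o_apply)
qed

section \<open>Uniqueness of the polynomial\<close>

lemma base_digits_unique:
  fixes a b :: "nat \<Rightarrow> nat"
  assumes "\<And>j. j < n \<Longrightarrow> a j < d" "\<And>j. j < n \<Longrightarrow> b j < d"
    and "(\<Sum>j<n. a j * d ^ j) = (\<Sum>j<n. b j * d ^ j)" and "j < n"
  shows "a j = b j"
  using assms
proof (induction n arbitrary: a b j)
  case (Suc n)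
  have split: "(\<Sum>j<Suc n. c j * d ^ j) = c 0 + d * (\<Sum>j<n. c (Suc j) * d ^ j)" for c
    by (simp add: sum.lessThan_Suc_shift sum_distrib_left mult.left_commute del: sum.lessThan_Suc)
  have eq: "a 0 + d * (\<Sum>j<n. a (Suc j) * d ^ j) = b 0 + d * (\<Sum>j<n. b (Suc j) * d ^ j)"
    using Suc.prems(3) unfolding split .
  have lt: "a 0 < d" "b 0 < d" using Suc.prems(1,2) by auto
  then have "a 0 = (a 0 + d * (\<Sum>j<n. a (Suc j) * d ^ j)) mod d" by simp
  also have "\<dots> = b 0" unfolding eq using lt by simp
  finally have "a 0 = b 0" .
  then have "(\<Sum>j<n. a (Suc j) * d ^ j) = (\<Sum>j<n. b (Suc j) * d ^ j)" using eq lt by simp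
  then have "a (Suc j) = b (Suc j)" if "j < n" for j
    using Suc.prems(1,2) that by (intro Suc.IH[of "\<lambda>j. a (Suc j)" "\<lambda>j. b (Suc j)"]) auto
  with \<open>a 0 = b 0\<close> Suc.prems(4) show ?case by (cases j) auto
qed simp

text \<open>Kronecker substitution: for a base \<open>d\<close> above all exponents, substituting the powers
  \<open>t ^ d ^ j\<close> sends distinct monomials to distinct powers of \<open>t\<close>; the smaller powers go to
  the \<open>q\<close>'s, in reverse order.\<close>

lemma pq_poly_eq_0:
  fixes D :: pq_poly
  assumes m: "m \<ge> 1" and vars: "pq_vars D \<subseteq> P ` {1..m} \<union> Q ` {1..m}"
    and zero: "\<And>p q. \<forall>i\<in>{1..m}. p i > 0 \<Longrightarrow> \<forall>i\<in>{1..m}. q i > 0 \<Longrightarrow>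
        \<forall>i\<in>{1..m}. \<forall>j\<in>{1..m}. i < j \<longrightarrow> q i > q j \<Longrightarrow> (\<Sum>i=1..m. p i * q i) \<ge> k \<Longrightarrow>
        pq_eval p q D = 0"
  shows "D = 0"
proof -
  \<comment> \<open>The sum bounds every single exponent. The summand 2 keeps \<open>d\<close> above
    1 even for constant polynomials, so that the powers of \<open>d\<close> strictly
    increase.\<close>
  define d where "d = 2 + (\<Sum>\<alpha>\<in>Poly_Mapping.keys D. \<Sum>v\<in>Poly_Mapping.keys \<alpha>. Poly_Mapping.lookup \<alpha> v)"
  have d: "d > 1" by (simp add: d_def)
  have lookup_less: "Poly_Mapping.lookup \<alpha> v < d" if \<alpha>: "\<alpha> \<in> Poly_Mapping.keys D" for \<alpha> v
  proof (cases "v \<in> Poly_Mapping.keys \<alpha>")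
    case True
    then have "Poly_Mapping.lookup \<alpha> v \<le> (\<Sum>v\<in>Poly_Mapping.keys \<alpha>. Poly_Mapping.lookup \<alpha> v)"
      by (intro member_le_sum) auto
    also have "\<dots> \<le> (\<Sum>\<alpha>\<in>Poly_Mapping.keys D. \<Sum>v\<in>Poly_Mapping.keys \<alpha>. Poly_Mapping.lookup \<alpha> v)"
      using \<alpha> by (intro member_le_sum[of \<alpha> _ "\<lambda>\<alpha>. \<Sum>v\<in>Poly_Mapping.keys \<alpha>. Poly_Mapping.lookup \<alpha> v"]) auto
    finally show ?thesis by (simp add: d_def)
  next
    case False
    then show ?thesis using d by (simp add: in_keys_iff)
  qed
  define var where "var j = (if j < m then Q (m - j) else P (j - m + 1))" for j
  have inj_var: "inj_on var {..<2 * m}" by (auto simp: inj_on_def var_def split: if_splits)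
  have var_img: "P ` {1..m} \<union> Q ` {1..m} \<subseteq> var ` {..<2 * m}"
  proof (intro Un_least image_subsetI)
    fix i assume "i \<in> {1..m}"
    then have "P i = var (m + i - 1)" "m + i - 1 < 2 * m" "Q i = var (m - i)" "m - i < 2 * m"
      by (auto simp: var_def)
    then show "P i \<in> var ` {..<2 * m}" "Q i \<in> var ` {..<2 * m}" by blast+
  qed
  define e where "e \<alpha> = (\<Sum>j<2 * m. Poly_Mapping.lookup \<alpha> (var j) * d ^ j)" for \<alpha> :: pq_monom
  have keys_sub: "Poly_Mapping.keys \<alpha> \<subseteq> var ` {..<2 * m}" if "\<alpha> \<in> Poly_Mapping.keys D" for \<alpha>
    using that vars var_img unfolding pq_vars_def by blast
  have inj_e: "\<alpha> = \<beta>" if "\<alpha> \<in> Poly_Mapping.keys D" "\<beta> \<in> Poly_Mapping.keys D" "e \<alpha> = e \<beta>" for \<alpha> \<beta>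
  proof (rule poly_mapping_eqI)
    fix v
    show "Poly_Mapping.lookup \<alpha> v = Poly_Mapping.lookup \<beta> v"
    proof (cases "v \<in> var ` {..<2 * m}")
      case True
      then obtain j where j: "j < 2 * m" "v = var j" by auto
      show ?thesis unfolding j(2)
        by (rule base_digits_unique[of "2 * m" _ d])
          (use that lookup_less j(1) in \<open>auto simp: e_def\<close>)
    next
      case False
      then have "v \<notin> Poly_Mapping.keys \<alpha>" "v \<notin> Poly_Mapping.keys \<beta>" using keys_sub that by blast+
      then show ?thesis by (simp add: in_keys_iff)
    qed
  qed
  define U where "U = (\<Sum>\<alpha>\<in>Poly_Mapping.keys D. Polynomial.monom (Poly_Mapping.lookup D \<alpha>) (e \<alpha>))"
  \<comment> \<open>The bound gives \<open>t > 1\<close>, which makes the powers substituted for the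
    \<open>q\<close> variables strictly decrease, and \<open>t \<ge> k\<close>, so that the first
    block alone has at least \<open>k\<close> boxes.\<close>
  have root: "poly U (real t) = 0" if t: "t \<ge> k + 2" for t
  proof -
    define p where "p i = t ^ d ^ (m + i - 1)" for i
    define q where "q i = t ^ d ^ (m - i)" for i
    have t1: "t > 1" using t by simp
    have "monom_val (\<lambda>v. case v of P i \<Rightarrow> real (p i) | Q i \<Rightarrow> real (q i)) \<alpha> = real t ^ e \<alpha>"
      if "\<alpha> \<in> Poly_Mapping.keys D" for \<alpha>
    proof -
      let ?s = "\<lambda>v. case v of P i \<Rightarrow> real (p i) | Q i \<Rightarrow> real (q i)"
      have s: "?s (var j) = real t ^ d ^ j" if "j < 2 * m" for j
        using that by (auto simp: var_def p_def q_def)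
      have "monom_val ?s \<alpha> = (\<Prod>v\<in>var ` {..<2 * m}. ?s v ^ Poly_Mapping.lookup \<alpha> v)"
        by (intro monom_val_superset keys_sub that) simp
      also have "\<dots> = (\<Prod>j<2 * m. ?s (var j) ^ Poly_Mapping.lookup \<alpha> (var j))"
        by (simp add: prod.reindex[OF inj_var])
      also have "\<dots> = (\<Prod>j<2 * m. real t ^ (Poly_Mapping.lookup \<alpha> (var j) * d ^ j))"
        by (intro prod.cong refl) (simp add: s mult.commute flip: power_mult)
      finally show ?thesis by (simp add: e_def power_sum)
    qed
    then have "poly U (real t) = pq_eval p q D"
      unfolding pq_eval_def by (subst pq_hom_superset[of _ "Poly_Mapping.keys D"])
        (auto simp: U_def poly_sum poly_monom)
    also have "\<dots> = 0"
    proof (rule zero)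
      show "\<forall>i\<in>{1..m}. p i > 0" "\<forall>i\<in>{1..m}. q i > 0" using t1 by (auto simp: p_def q_def)
      show "\<forall>i\<in>{1..m}. \<forall>j\<in>{1..m}. i < j \<longrightarrow> q i > q j"
        unfolding q_def using t1 d by (auto intro!: power_strict_increasing)
      have "k \<le> t ^ 1" using t by simp
      also have "\<dots> \<le> p 1" unfolding p_def using t1 d by (intro power_increasing) auto
      also have "\<dots> \<le> p 1 * q 1" using t1 by (simp add: q_def)
      also have "\<dots> \<le> (\<Sum>i=1..m. p i * q i)" using m by (intro member_le_sum[of 1 _ "\<lambda>i. p i * q i"]) auto
      finally show "(\<Sum>i=1..m. p i * q i) \<ge> k" .
    qed
    finally show ?thesis .
  qed
  have "U = 0"
  proof (rule ccontr)
    assume "U \<noteq> 0"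
    then have "finite {x. poly U x = 0}" by (rule poly_roots_finite)
    moreover have "real ` {k + 2..} \<subseteq> {x. poly U x = 0}" using root by auto
    ultimately have "finite (real ` {k + 2..})" by (rule finite_subset[rotated])
    then show False by (simp add: finite_image_iff infinite_Ici)
  qed
  have "Poly_Mapping.keys D = {}"
  proof (rule ccontr)
    assume "Poly_Mapping.keys D \<noteq> {}"
    then obtain \<alpha> where \<alpha>: "\<alpha> \<in> Poly_Mapping.keys D" by blast
    \<comment> \<open>As \<open>e\<close> is injective on the monomials of \<open>D\<close>, no two
      of them share a power of \<open>t\<close>, and the coefficients of \<open>D\<close> can be
      read off from \<open>U\<close>.\<close>
    have "0 = coeff U (e \<alpha>)" using \<open>U = 0\<close> by simp
    also have "\<dots> = (\<Sum>\<beta>\<in>Poly_Mapping.keys D. if \<beta> = \<alpha> then Poly_Mapping.lookup D \<beta> else 0)"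
      unfolding U_def coeff_sum coeff_monom by (intro sum.cong refl) (use inj_e \<alpha> in auto)
    also have "\<dots> = Poly_Mapping.lookup D \<alpha>" using \<alpha> by simp
    finally show False using \<alpha> by (simp add: in_keys_iff)
  qed
  then show ?thesis by simp
qed

lemma stanley_poly_eq_factorization_poly:
  assumes "m \<ge> 1"
  shows "stanley_poly m k = factorization_poly m k"
  unfolding stanley_poly_def
proof (rule the_equality)
  show "is_stanley_poly m k (factorization_poly m k)" by (rule is_stanley_poly_factorization_poly)
  fix F assume F: "is_stanley_poly m k F"
  let ?G = "factorization_poly m k"
  note G = is_stanley_poly_factorization_poly[of m k]
  have "F - ?G = 0"
  proof (rule pq_poly_eq_0[OF assms])
    have "pq_vars (F - ?G) \<subseteq> pq_vars F \<union> pq_vars ?G"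
      unfolding pq_vars_def UN_Un[symmetric] by (rule UN_mono[OF keys_diff order_refl])
    also have "\<dots> \<subseteq> P ` {1..m} \<union> Q ` {1..m}"
      by (rule Un_least[OF F[unfolded is_stanley_poly_def, THEN conjunct1]
            G[unfolded is_stanley_poly_def, THEN conjunct1]])
    finally show "pq_vars (F - ?G) \<subseteq> P ` {1..m} \<union> Q ` {1..m}" .
    fix p q :: "nat \<Rightarrow> nat"
    assume "\<forall>i\<in>{1..m}. p i > 0" "\<forall>i\<in>{1..m}. q i > 0"
      "\<forall>i\<in>{1..m}. \<forall>j\<in>{1..m}. i < j \<longrightarrow> q i > q j" "(\<Sum>i=1..m. p i * q i) \<ge> k"
    then have "complex_of_real (pq_eval p q F) = complex_of_real (pq_eval p q ?G)"
      using F[unfolded is_stanley_poly_def, THEN conjunct2, rule_format, of p q]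
        G[unfolded is_stanley_poly_def, THEN conjunct2, rule_format, of p q] by simp
    then show "pq_eval p q (F - ?G) = 0" by (simp add: pq_eval_diff)
  qed
  then show "F = ?G" by simp
qed

section \<open>The substitution of \<open>-q\<close> and positivity\<close>

lemma prod_pq_indet:
  "(\<Prod>i\<in>I. pq_indet (f i)) = Poly_Mapping.single (\<Sum>i\<in>I. Poly_Mapping.single (f i) 1) 1"
  by (induction I rule: infinite_finite_induct) (auto simp: pq_indet_def mult_single)

text \<open>Each cycle of \<open>\<sigma>'\<close> brings one \<open>q\<close>, hence one change of
  sign.\<close>

lemma negate_q_single_cycle_monom:
  "negate_q (Poly_Mapping.single (cycle_monom k \<sigma> \<sigma>' \<phi>) (of_int c)) =
     of_int (c * (-1) ^ card (orbit \<sigma>' ` {..<k})) * Poly_Mapping.single (cycle_monom k \<sigma> \<sigma>' \<phi>) 1"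
proof -
  have "negate_q (Poly_Mapping.single (cycle_monom k \<sigma> \<sigma>' \<phi>) (of_int c)) = pq_const (of_int c) *
      ((\<Prod>X\<in>orbit \<sigma> ` {..<k}. pq_indet (P (Max (\<phi> ` X)))) *
       (\<Prod>X\<in>orbit \<sigma>' ` {..<k}. - pq_indet (Q (Max (\<phi> ` X)))))"
    unfolding negate_q_def
    by (subst pq_hom_single) (simp_all add: pq_const_def monom_val_cycle_monom)
  also have "\<dots> = of_int (c * (-1) ^ card (orbit \<sigma>' ` {..<k})) *
      ((\<Prod>X\<in>orbit \<sigma> ` {..<k}. pq_indet (P (Max (\<phi> ` X)))) *
       (\<Prod>X\<in>orbit \<sigma>' ` {..<k}. pq_indet (Q (Max (\<phi> ` X)))))"
    by (simp add: pq_const_def prod_uminus mult_ac)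
  also have "\<dots> = of_int (c * (-1) ^ card (orbit \<sigma>' ` {..<k})) *
      Poly_Mapping.single (cycle_monom k \<sigma> \<sigma>' \<phi>) 1"
    by (simp add: prod_pq_indet mult_single cycle_monom_def)
  finally show ?thesis .
qed

text \<open>By \<open>sign_orbits\<close> the sign of the cofactor and the signs from its cycles
  combine to \<open>(-1) ^ k\<close>, the same for every term, and the prefactor cancels it.\<close>

lemma negate_q_factorization_poly:
  "(-1) ^ k * negate_q (factorization_poly m k) =
     (\<Sum>\<sigma>\<in>perms k. \<Sum>\<phi>\<in>invariant_fns k \<sigma> (\<lambda>_. {1..m}).
        Poly_Mapping.single (cycle_monom k \<sigma> (inv \<sigma> \<circ> inv (cycle_of_list [0..<k])) \<phi>) 1)"
proof -
  let ?c = "\<lambda>\<sigma>. inv \<sigma> \<circ> inv (cycle_of_list [0..<k])"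
  have const: "pq_const 0 = 0" "pq_const (a + b) = pq_const a + pq_const b" for a b
    by (simp_all add: pq_const_def single_add)
  have "negate_q (factorization_poly m k) =
      (\<Sum>\<sigma>\<in>perms k. \<Sum>\<phi>\<in>invariant_fns k \<sigma> (\<lambda>_. {1..m}).
        negate_q (Poly_Mapping.single (cycle_monom k \<sigma> (?c \<sigma>) \<phi>) (of_int (sign (?c \<sigma>)))))"
    unfolding factorization_poly_def negate_q_def
    by (simp only: pq_hom_sum[of pq_const, OF const])
  also have "\<dots> = (\<Sum>\<sigma>\<in>perms k. \<Sum>\<phi>\<in>invariant_fns k \<sigma> (\<lambda>_. {1..m}).
        (-1) ^ k * Poly_Mapping.single (cycle_monom k \<sigma> (?c \<sigma>) \<phi>) 1)"
    unfolding negate_q_single_cycle_monom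
    by (intro sum.cong refl) (simp only: sign_orbits[OF cofactor_perms], simp)
  finally show ?thesis
    by (simp add: sum_distrib_left mult.assoc[symmetric] power_mult_distrib[symmetric] del: o_apply)
qed

text \<open>Keys carry nonzero coefficients, so nonnegativity suffices; it survives the merging of
  equal monomials.\<close>

lemma pq_positive_homogeneous_component:
  assumes "\<And>\<alpha>. Poly_Mapping.lookup F \<alpha> \<ge> 0"
  shows "pq_positive (homogeneous_component d F)"
  unfolding pq_positive_def
proof
  fix \<alpha> assume "\<alpha> \<in> Poly_Mapping.keys (homogeneous_component d F)"
  then have "Poly_Mapping.lookup (homogeneous_component d F) \<alpha> \<noteq> 0" by (simp add: in_keys_iff)
  moreover have "Poly_Mapping.lookup (homogeneous_component d F) \<alpha> \<ge> 0"
    unfolding homogeneous_component_def lookup_sum lookup_single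
    using assms by (intro sum_nonneg) (auto simp: when_def)
  ultimately show "Poly_Mapping.lookup (homogeneous_component d F) \<alpha> > 0" by simp
qed

theorem corollary4p7:
  fixes m k :: nat
  assumes "m \<ge> 1" and "k \<ge> 3"
  shows "pq_positive (homogeneous_component (k - 1) ((- 1) ^ k * negate_q (stanley_poly m k)))"
proof (rule pq_positive_homogeneous_component)
  fix \<alpha>
  show "Poly_Mapping.lookup ((- 1) ^ k * negate_q (stanley_poly m k)) \<alpha> \<ge> 0"
    unfolding stanley_poly_eq_factorization_poly[OF assms(1)] negate_q_factorization_poly
      lookup_sum lookup_single
    by (intro sum_nonneg) (auto simp: when_def)
qed

end
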